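(* Let $E$ be a real Hausdorff locally convex space and $C\subset E$ a convex subset. Then $$\mathrm{bDP}(C)=\mathrm{bPC}(C)\cap \sigma(E,E^* )\text{-s-ext}(C)=\mathrm{bPC}(C)\cap \mathrm{ext}(\widetilde{C}),$$ where points $x\in C$ are identified with their canonical images in $E^{**}$.
   Context: $(E,\tau)$ is a real Hausdorff locally convex space, $\tau(x)$ is the family of $\tau$-neighbourhoods of $x$, $E^*$ its topological dual, $\sigma(E,E^* )$ the weak topology and $\sigma(E,E^* )(x)$ the family of weak neighbourhoods of $x$. The strong topology $\beta(E^*,E)$ on $E^*$ is the topology of uniform convergence on bounded subsets of $E$; $E^{**}$ is the dual of $(E^*,\beta(E^*,E))$; $J_E:E\to E^{**}$, $J_E(x)(x^* )=x^*(x)$, is used to identify $x$ with $J_E(x)$. $\widetilde{C}$ is the $\sigma(E^{**},E^* )$-closure of $J_E(C)$ in $E^{**}$. For convex $C\subset E$ and $x\in C$: - $x\in \mathrm{DP}(C)$ (denting point) if for every $U\in\tau(x)$, $x\notin\overline{\mathrm{conv}}(C\setminus U)$. - $x\in\mathrm{bDP}(C)$ (bounded denting point) if $x\in \mathrm{DP}(C)$ and there is $W\in\sigma(E,E^* )(x)$ with $W\cap C$ bounded. - $x\in \mathrm{PC}(C)$ (point of continuity) if for every $U\in\tau(x)$ there is $W\in\sigma(E,E^* )(x)$ with $W\cap C\subset U$. - $x\in\mathrm{bPC}(C)$ (bounded point of continuity) if $x\in\mathrm{PC}(C)$ and there is $W\in\sigma(E,E^* )(x)$ with $W\cap C$ bounded.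 - $x\in\sigma(E,E^* )\text{-s-ext}(C)$ if for all nets $(c_\gamma)_{\gamma\in\Gamma},(c'_\gamma)_{\gamma\in\Gamma}$ in $C$ (same index set) with $\lim_\gamma \frac{c_\gamma+c'_\gamma}{2}=x$ in $\tau$, one has $\lim_\gamma c_\gamma=x$ in $\sigma(E,E^* )$. For a convex set $D$ in a vector space, $x\in\mathrm{ext}(D)$ (extreme point) if $x\in D$ and $x=\frac{d_1+d_2}{2}$ with $d_1,d_2\in D$ implies $x=d_1=d_2$. *)

theory Defs
  imports "HOL-Analysis.Analysis"
begin

section \<open>Hausdorff locally convex spaces\<close>

text \<open>The first axiom is joint continuity of scalar multiplication, phrased as the library does
  for addition in \<^class>\<open>topological_monoid_add\<close>. The second is local convexity at the origin;
  by translation it holds at every point. (The constant \<^const>\<open>convex\<close> is unavailable in a class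
  specification, hence its unfolding; see \<open>locally_convex\<close>.)\<close>

class locally_convex_space = real_vector + topological_ab_group_add + t2_space +
  assumes tendsto_scaleR_Pair:
      "LIM p (nhds c \<times>\<^sub>F nhds x). fst p *\<^sub>R snd p :> nhds (c *\<^sub>R x)"
    and locally_convex_0:
      "open U \<Longrightarrow> 0 \<in> U \<Longrightarrow> \<exists>V. open V \<and> 0 \<in> V \<and> V \<subseteq> U \<and>
        (\<forall>x\<in>V. \<forall>y\<in>V. \<forall>u\<ge>0. \<forall>v\<ge>0. u + v = 1 \<longrightarrow> u *\<^sub>R x + v *\<^sub>R y \<in> V)"

lemma locally_convex:
  fixes U :: "'a::locally_convex_space set"
  assumes "open U" "0 \<in> U"
  shows "\<exists>V. open V \<and> 0 \<in> V \<and> V \<subseteq> U \<and> convex V"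
  unfolding convex_def by (rule locally_convex_0[OF assms])

definition nbhds_of :: "'a topology \<Rightarrow> 'a \<Rightarrow> 'a set set" where
  "nbhds_of T x = {U. \<exists>V. openin T V \<and> x \<in> V \<and> V \<subseteq> U}"

definition tvs_bounded :: "'a::locally_convex_space set \<Rightarrow> bool" where
  "tvs_bounded B \<longleftrightarrow>
    (\<forall>U \<in> nbhds_of euclidean 0. \<exists>s>0. \<forall>t>s. B \<subseteq> (\<lambda>u. t *\<^sub>R u) ` U)"

section \<open>The strong dual\<close>

typedef (overloaded) ('a::locally_convex_space) cdual =
  "{f :: 'a \<Rightarrow> real. linear f \<and> continuous_on UNIV f}"
  morphisms dual_apply Abs_cdual
  by (rule exI[of _ "\<lambda>_. 0"]) (auto simp: linear_iff)

setup_lifting type_definition_cdual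

instantiation cdual :: (locally_convex_space) real_vector
begin

lift_definition zero_cdual :: "'a cdual" is "\<lambda>_. 0"
  by (auto simp: linear_iff)

lift_definition plus_cdual :: "'a cdual \<Rightarrow> 'a cdual \<Rightarrow> 'a cdual" is "\<lambda>f g x. f x + g x"
  by (auto simp: linear_iff algebra_simps intro: continuous_intros)

lift_definition minus_cdual :: "'a cdual \<Rightarrow> 'a cdual \<Rightarrow> 'a cdual" is "\<lambda>f g x. f x - g x"
  by (auto simp: linear_iff algebra_simps intro: continuous_intros)

lift_definition uminus_cdual :: "'a cdual \<Rightarrow> 'a cdual" is "\<lambda>f x. - f x"
  by (auto simp: linear_iff algebra_simps intro: continuous_intros)

lift_definition scaleR_cdual :: "real \<Rightarrow> 'a cdual \<Rightarrow> 'a cdual" is "\<lambda>c f x. c * f x"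
  by (auto simp: linear_iff algebra_simps intro: continuous_intros)

instance
  by standard (transfer; auto simp: algebra_simps)+

end

text \<open>The topology carried by \<^typ>\<open>'a cdual\<close> is the strong topology: the sets
  \<open>dual_nbhd B e f\<close>, for bounded \<open>B\<close> and positive \<open>e\<close>, form a base of neighbourhoods of \<open>f\<close>.\<close>

definition dual_nbhd :: "'a::locally_convex_space set \<Rightarrow> real \<Rightarrow> 'a cdual \<Rightarrow> 'a cdual set" where
  "dual_nbhd B e f = {g. \<forall>x\<in>B. \<bar>dual_apply g x - dual_apply f x\<bar> < e}"

lemma tvs_bounded_subset: "tvs_bounded B \<Longrightarrow> A \<subseteq> B \<Longrightarrow> tvs_bounded A"
  unfolding tvs_bounded_def by (meson order_trans)

lemma tvs_boundedD:
  "tvs_bounded B \<Longrightarrow> U \<in> nbhds_of euclidean 0 \<Longrightarrow> \<exists>s>0. \<forall>t>s. B \<subseteq> (\<lambda>u. t *\<^sub>R u) ` U"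
  unfolding tvs_bounded_def by (rule bspec)

lemma tvs_bounded_Un:
  assumes A: "tvs_bounded A" and B: "tvs_bounded B"
  shows "tvs_bounded (A \<union> B)"
  unfolding tvs_bounded_def
proof
  fix U :: "'a set" assume U: "U \<in> nbhds_of euclidean 0"
  obtain s where s: "s > 0" "\<forall>t>s. A \<subseteq> (\<lambda>u. t *\<^sub>R u) ` U"
    using tvs_boundedD[OF A U] by blast
  obtain s' where s': "s' > 0" "\<forall>t>s'. B \<subseteq> (\<lambda>u. t *\<^sub>R u) ` U"
    using tvs_boundedD[OF B U] by blast
  have "A \<union> B \<subseteq> (\<lambda>u. t *\<^sub>R u) ` U" if "t > max s s'" for t
    using s(2)[rule_format, of t] s'(2)[rule_format, of t] that by simp
  then show "\<exists>s>0. \<forall>t>s. A \<union> B \<subseteq> (\<lambda>u. t *\<^sub>R u) ` U"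
    using s(1) by (intro exI[of _ "max s s'"]) auto
qed

lemma tvs_bounded_singleton: "tvs_bounded {x}" for x :: "'a::locally_convex_space"
  unfolding tvs_bounded_def
proof
  fix U :: "'a set" assume "U \<in> nbhds_of euclidean 0"
  then obtain V where V: "open V" "0 \<in> V" "V \<subseteq> U"
    by (auto simp: nbhds_of_def)
  have "eventually (\<lambda>p. fst p *\<^sub>R snd p \<in> V) (nhds (0::real) \<times>\<^sub>F nhds x)"
    using tendsto_scaleR_Pair[of 0 x] V by (auto simp: filterlim_iff eventually_nhds)
  then obtain P Q where PQ: "eventually P (nhds (0::real))" "eventually Q (nhds x)"
      "\<And>c y. P c \<Longrightarrow> Q y \<Longrightarrow> c *\<^sub>R y \<in> V"
    unfolding eventually_prod_filter by auto
  then have "Q x" by (auto dest: eventually_nhds_x_imp_x)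
  obtain d where d: "d > 0" "\<And>c. \<bar>c\<bar> < d \<Longrightarrow> P c"
    using PQ(1) unfolding eventually_nhds_metric by (auto simp: dist_real_def)
  have "x \<in> (\<lambda>u. t *\<^sub>R u) ` U" if t: "t > 1/d" for t
  proof -
    have "1/d > 0" using d by simp
    with t have tp: "t > 0" by linarith
    have "\<bar>1/t\<bar> < d" using t tp d(1) by (simp add: field_simps)
    then have "(1/t) *\<^sub>R x \<in> V" using d PQ(3) \<open>Q x\<close> by blast
    moreover have "x = t *\<^sub>R ((1/t) *\<^sub>R x)" using tp by simp
    ultimately show ?thesis using V by blast
  qed
  then show "\<exists>s>0. \<forall>t>s. {x} \<subseteq> (\<lambda>u. t *\<^sub>R u) ` U"
    using d(1) by (intro exI[of _ "1/d"]) auto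
qed

instantiation cdual :: (locally_convex_space) topological_space
begin

definition open_cdual :: "'a cdual set \<Rightarrow> bool" where
  "open_cdual V \<longleftrightarrow> (\<forall>f\<in>V. \<exists>B e. tvs_bounded B \<and> e > 0 \<and> dual_nbhd B e f \<subseteq> V)"

instance
proof
  show "open (UNIV :: 'a cdual set)"
    using tvs_bounded_singleton[of 0] unfolding open_cdual_def by (auto intro: exI[of _ 1])
next
  fix S T :: "'a cdual set" assume ST: "open S" "open T"
  show "open (S \<inter> T)"
    unfolding open_cdual_def
  proof
    fix f assume f: "f \<in> S \<inter> T"
    obtain A a where A: "tvs_bounded A" "a > 0" "dual_nbhd A a f \<subseteq> S"
      using ST f unfolding open_cdual_def by blast
    obtain B b where B: "tvs_bounded B" "b > 0" "dual_nbhd B b f \<subseteq> T"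
      using ST f unfolding open_cdual_def by blast
    have "dual_nbhd (A \<union> B) (min a b) f \<subseteq> dual_nbhd A a f \<inter> dual_nbhd B b f"
      by (auto simp: dual_nbhd_def)
    with A B show "\<exists>B e. tvs_bounded B \<and> e > 0 \<and> dual_nbhd B e f \<subseteq> S \<inter> T"
      by (intro exI[of _ "A \<union> B"] exI[of _ "min a b"]) (auto intro: tvs_bounded_Un)
  qed
next
  fix K :: "'a cdual set set" assume "\<forall>S\<in>K. open S"
  then show "open (\<Union>K)"
    unfolding open_cdual_def by (meson Union_iff Union_upper subset_trans)
qed

end

lemma bounded_dual_apply:
  fixes f :: "'a::locally_convex_space cdual"
  assumes "tvs_bounded B"
  shows "\<exists>M>0. \<forall>x\<in>B. \<bar>dual_apply f x\<bar> < M"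
proof -
  have f: "linear (dual_apply f)" "continuous_on UNIV (dual_apply f)"
    using dual_apply[of f] by auto
  have "open (dual_apply f -` {-1<..<1})"
    using f(2) open_greaterThanLessThan[of "-1" "1::real"] by (simp add: continuous_on_open_vimage)
  then have "dual_apply f -` {-1<..<1} \<in> nbhds_of euclidean 0"
    using linear_0[OF f(1)] unfolding nbhds_of_def by auto
  then obtain s where s: "s > 0" "\<forall>t>s. B \<subseteq> (\<lambda>u. t *\<^sub>R u) ` (dual_apply f -` {-1<..<1})"
    using tvs_boundedD[OF assms] by blast
  show ?thesis
  proof (intro exI[of _ "s + 1"] conjI ballI)
    show "s + 1 > 0" using s(1) by simp
    fix x assume "x \<in> B"
    moreover have "B \<subseteq> (\<lambda>u. (s + 1) *\<^sub>R u) ` (dual_apply f -` {-1<..<1})"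
      using s by simp
    ultimately have "x \<in> (\<lambda>u. (s + 1) *\<^sub>R u) ` (dual_apply f -` {-1<..<1})"
      by (rule subsetD[rotated])
    then obtain u where ux: "x = (s + 1) *\<^sub>R u" and "u \<in> dual_apply f -` {-1<..<1}"
      by (rule imageE)
    then have u: "-1 < dual_apply f u" "dual_apply f u < 1" by auto
    have "\<bar>dual_apply f x\<bar> = (s + 1) * \<bar>dual_apply f u\<bar>"
      using ux s(1) linear_cmul[OF f(1)] by (simp add: abs_mult)
    also have "\<dots> < (s + 1) * 1"
      using u s(1) by (intro mult_strict_left_mono) auto
    finally show "\<bar>dual_apply f x\<bar> < s + 1" by simp
  qed
qed

definition dual_core :: "'a::locally_convex_space set \<Rightarrow> real \<Rightarrow> 'a cdual \<Rightarrow> 'a cdual set" where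
  "dual_core B e f = {g. \<exists>d<e. \<forall>x\<in>B. \<bar>dual_apply g x - dual_apply f x\<bar> \<le> d}"

lemma dual_core_subset: "dual_core B e f \<subseteq> dual_nbhd B e f"
  by (force simp: dual_core_def dual_nbhd_def)

lemma dual_core_self: "e > 0 \<Longrightarrow> f \<in> dual_core B e f"
  by (auto simp: dual_core_def)

lemma open_dual_core: "open (dual_core B e f)" if "tvs_bounded B"
  unfolding open_cdual_def
proof
  fix g assume "g \<in> dual_core B e f"
  then obtain d where d: "d < e" "\<And>x. x \<in> B \<Longrightarrow> \<bar>dual_apply g x - dual_apply f x\<bar> \<le> d"
    by (auto simp: dual_core_def)
  have "dual_nbhd B ((e - d) / 2) g \<subseteq> dual_core B e f"
  proof
    fix h assume h: "h \<in> dual_nbhd B ((e - d) / 2) g"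
    have "\<bar>dual_apply h x - dual_apply f x\<bar> \<le> d + (e - d) / 2" if "x \<in> B" for x
    proof -
      have "\<bar>dual_apply h x - dual_apply g x\<bar> < (e - d) / 2"
        using h that by (auto simp: dual_nbhd_def)
      then show ?thesis using d(2)[OF that] by linarith
    qed
    moreover have "d + (e - d) / 2 < e" using d(1) by (simp add: field_simps)
    ultimately show "h \<in> dual_core B e f" unfolding dual_core_def by blast
  qed
  then show "\<exists>B' e'. tvs_bounded B' \<and> e' > 0 \<and> dual_nbhd B' e' g \<subseteq> dual_core B e f"
    using that d(1) by (intro exI[of _ B] exI[of _ "(e - d) / 2"]) auto
qed

lemma eventually_nhds_cdual:
  "eventually P (nhds f) \<longleftrightarrow>
    (\<exists>B e. tvs_bounded B \<and> e > 0 \<and> (\<forall>g \<in> dual_nbhd B e f. P g))"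
proof
  assume "eventually P (nhds f)"
  then obtain S where "open S" "f \<in> S" "\<forall>g\<in>S. P g"
    by (auto simp: eventually_nhds)
  then show "\<exists>B e. tvs_bounded B \<and> e > 0 \<and> (\<forall>g \<in> dual_nbhd B e f. P g)"
    unfolding open_cdual_def by (meson subset_iff)
next
  assume "\<exists>B e. tvs_bounded B \<and> e > 0 \<and> (\<forall>g \<in> dual_nbhd B e f. P g)"
  then show "eventually P (nhds f)"
    using open_dual_core dual_core_self dual_core_subset
    unfolding eventually_nhds by (metis subset_iff)
qed

lemma tendsto_cdual_iff:
  fixes f :: "'a::locally_convex_space cdual"
  shows "filterlim h (nhds f) F \<longleftrightarrow>
    (\<forall>B e. tvs_bounded B \<longrightarrow> e > 0 \<longrightarrow>
      eventually (\<lambda>i. \<forall>x\<in>B. \<bar>dual_apply (h i) x - dual_apply f x\<bar> < e) F)"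
    (is "?L \<longleftrightarrow> ?R")
proof
  assume L: ?L
  show ?R
  proof (intro allI impI)
    fix B :: "'a set" and e :: real assume "tvs_bounded B" "e > 0"
    then have "eventually (\<lambda>g. g \<in> dual_nbhd B e f) (nhds f)"
      unfolding eventually_nhds_cdual by auto
    then have "eventually (\<lambda>i. h i \<in> dual_nbhd B e f) F"
      using L unfolding filterlim_iff by blast
    then show "eventually (\<lambda>i. \<forall>x\<in>B. \<bar>dual_apply (h i) x - dual_apply f x\<bar> < e) F"
      by (simp add: dual_nbhd_def)
  qed
next
  assume R: ?R
  show ?L
    unfolding filterlim_iff
  proof (intro allI impI)
    fix P assume "eventually P (nhds f)"
    then obtain B e where Be: "tvs_bounded B" "e > 0" "\<forall>g \<in> dual_nbhd B e f. P g"
      unfolding eventually_nhds_cdual by blast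
    have "eventually (\<lambda>i. \<forall>x\<in>B. \<bar>dual_apply (h i) x - dual_apply f x\<bar> < e) F"
      using R Be by blast
    then show "eventually (\<lambda>i. P (h i)) F"
      by eventually_elim (use Be in \<open>auto simp: dual_nbhd_def\<close>)
  qed
qed

lemma eventually_dual_nbhd:
  "tvs_bounded B \<Longrightarrow> e > 0 \<Longrightarrow> eventually (\<lambda>g. g \<in> dual_nbhd B e f) (nhds f)"
  unfolding eventually_nhds_cdual by auto

instance cdual :: (locally_convex_space) locally_convex_space
proof
  fix f g :: "'a cdual"
  show "LIM p (nhds f \<times>\<^sub>F nhds g). fst p + snd p :> nhds (f + g)"
    unfolding tendsto_cdual_iff
  proof (intro allI impI)
    fix B :: "'a set" and e :: real assume Be: "tvs_bounded B" "e > 0"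
    have "eventually (\<lambda>p. fst p \<in> dual_nbhd B (e/2) f \<and> snd p \<in> dual_nbhd B (e/2) g)
        (nhds f \<times>\<^sub>F nhds g)"
      using Be by (intro eventually_prodI eventually_dual_nbhd) auto
    then show "eventually (\<lambda>p. \<forall>x\<in>B. \<bar>dual_apply (fst p + snd p) x - dual_apply (f + g) x\<bar> < e)
        (nhds f \<times>\<^sub>F nhds g)"
    proof eventually_elim
      case (elim p)
      have "\<bar>dual_apply (fst p + snd p) x - dual_apply (f + g) x\<bar> < e" if "x \<in> B" for x
      proof -
        have "\<bar>dual_apply (fst p) x - dual_apply f x\<bar> < e/2"
             "\<bar>dual_apply (snd p) x - dual_apply g x\<bar> < e/2"
          using elim that by (auto simp: dual_nbhd_def)
        then show ?thesis unfolding plus_cdual.rep_eq by linarith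
      qed
      then show ?case by blast
    qed
  qed
next
  fix f :: "'a cdual"
  show "(uminus \<longlongrightarrow> - f) (nhds f)"
    unfolding tendsto_cdual_iff
  proof (intro allI impI)
    fix B :: "'a set" and e :: real assume Be: "tvs_bounded B" "e > 0"
    show "eventually (\<lambda>g. \<forall>x\<in>B. \<bar>dual_apply (- g) x - dual_apply (- f) x\<bar> < e) (nhds f)"
      using eventually_dual_nbhd[OF Be, of f]
      by eventually_elim (force simp: dual_nbhd_def uminus_cdual.rep_eq)
  qed
next
  fix f g :: "'a cdual" assume "f \<noteq> g"
  then obtain x where x: "dual_apply f x \<noteq> dual_apply g x"
    by (metis dual_apply_inject ext)
  define e where "e = \<bar>dual_apply f x - dual_apply g x\<bar> / 2"
  have e: "e > 0" using x by (simp add: e_def)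
  have "dual_core {x} e f \<inter> dual_core {x} e g = {}"
  proof (rule equals0I)
    fix h assume "h \<in> dual_core {x} e f \<inter> dual_core {x} e g"
    then have "\<bar>dual_apply h x - dual_apply f x\<bar> < e" "\<bar>dual_apply h x - dual_apply g x\<bar> < e"
      unfolding dual_core_def by auto
    moreover have "\<bar>dual_apply f x - dual_apply g x\<bar> = 2 * e" by (simp add: e_def)
    ultimately show False by linarith
  qed
  then show "\<exists>U V. open U \<and> open V \<and> f \<in> U \<and> g \<in> V \<and> U \<inter> V = {}"
    using open_dual_core[OF tvs_bounded_singleton, of x e f]
      open_dual_core[OF tvs_bounded_singleton, of x e g] dual_core_self[OF e]
    by (intro exI[of _ "dual_core {x} e f"] exI[of _ "dual_core {x} e g"] conjI)
next
  fix c :: real and f :: "'a cdual"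
  show "LIM p (nhds c \<times>\<^sub>F nhds f). fst p *\<^sub>R snd p :> nhds (c *\<^sub>R f)"
    unfolding tendsto_cdual_iff
  proof (intro allI impI)
    fix B :: "'a set" and e :: real assume Be: "tvs_bounded B" "e > 0"
    obtain M where M: "M > 0" "\<forall>x\<in>B. \<bar>dual_apply f x\<bar> < M"
      using bounded_dual_apply[OF Be(1), of f] by blast
    define a where "a = min 1 (e / (2 * M))"
    define b where "b = e / (2 * (\<bar>c\<bar> + 1))"
    have ab: "a > 0" "b > 0" using Be M by (auto simp: a_def b_def)
    have aM: "a * M \<le> e/2"
    proof -
      have "a * M \<le> e / (2 * M) * M" using M by (intro mult_right_mono) (auto simp: a_def)
      then show ?thesis using M by simp
    qed
    have "eventually (\<lambda>k. \<bar>k - c\<bar> < a) (nhds c)"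
      using ab unfolding eventually_nhds_metric by (auto simp: dist_real_def)
    then have "eventually (\<lambda>p. \<bar>fst p - c\<bar> < a \<and> snd p \<in> dual_nbhd B b f) (nhds c \<times>\<^sub>F nhds f)"
      using Be ab by (intro eventually_prodI eventually_dual_nbhd) auto
    then show "eventually (\<lambda>p. \<forall>x\<in>B.
        \<bar>dual_apply (fst p *\<^sub>R snd p) x - dual_apply (c *\<^sub>R f) x\<bar> < e) (nhds c \<times>\<^sub>F nhds f)"
    proof eventually_elim
      case (elim p)
      have "\<bar>dual_apply (fst p *\<^sub>R snd p) x - dual_apply (c *\<^sub>R f) x\<bar> < e" if "x \<in> B" for x
      proof -
        let ?g = "dual_apply (snd p) x" and ?f = "dual_apply f x"
        have 1: "\<bar>?g - ?f\<bar> < b" using elim that by (auto simp: dual_nbhd_def)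
        have 2: "\<bar>fst p\<bar> \<le> \<bar>c\<bar> + 1" using elim by (auto simp: a_def)
        have "\<bar>fst p\<bar> * \<bar>?g - ?f\<bar> \<le> (\<bar>c\<bar> + 1) * \<bar>?g - ?f\<bar>"
          using 2 by (intro mult_right_mono) auto
        also have "\<dots> < (\<bar>c\<bar> + 1) * b"
          using 1 by (intro mult_strict_left_mono) auto
        also have "\<dots> = e/2" by (simp add: b_def field_simps)
        finally have 3: "\<bar>fst p * (?g - ?f)\<bar> < e/2" by (simp add: abs_mult)
        have "\<bar>fst p - c\<bar> * \<bar>?f\<bar> \<le> a * M"
          using elim bspec[OF M(2) that] ab by (intro mult_mono) auto
        then have 4: "\<bar>(fst p - c) * ?f\<bar> \<le> e/2" using aM by (simp add: abs_mult)
        have "fst p * ?g - c * ?f = fst p * (?g - ?f) + (fst p - c) * ?f"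
          by (simp add: algebra_simps)
        then show ?thesis using 3 4 by (simp add: scaleR_cdual.rep_eq)
      qed
      then show ?case by blast
    qed
  qed
next
  fix U :: "'a cdual set" assume "open U" "0 \<in> U"
  then obtain B e where Be: "tvs_bounded B" "e > 0" "dual_nbhd B e 0 \<subseteq> U"
    unfolding open_cdual_def by blast
  have "convex (dual_core B e 0)"
    unfolding convex_def
  proof (intro ballI allI impI)
    fix f g :: "'a cdual" and u v :: real
    assume fg: "f \<in> dual_core B e 0" "g \<in> dual_core B e 0" and uv: "0 \<le> u" "0 \<le> v" "u + v = 1"
    obtain a where a: "a < e" "\<And>x. x \<in> B \<Longrightarrow> \<bar>dual_apply f x\<bar> \<le> a"
      using fg(1) by (auto simp: dual_core_def zero_cdual.rep_eq)
    obtain b where b: "b < e" "\<And>x. x \<in> B \<Longrightarrow> \<bar>dual_apply g x\<bar> \<le> b"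
      using fg(2) by (auto simp: dual_core_def zero_cdual.rep_eq)
    have "\<bar>u * dual_apply f x + v * dual_apply g x\<bar> \<le> max a b" if "x \<in> B" for x
    proof -
      have "\<bar>u * dual_apply f x + v * dual_apply g x\<bar>
          \<le> u * \<bar>dual_apply f x\<bar> + v * \<bar>dual_apply g x\<bar>"
        using uv abs_triangle_ineq[of "u * dual_apply f x" "v * dual_apply g x"]
        by (simp add: abs_mult)
      also have "\<dots> \<le> u * max a b + v * max a b"
        using a(2)[OF that] b(2)[OF that] uv by (intro add_mono mult_left_mono) auto
      also have "\<dots> = max a b" using uv by (simp flip: distrib_right)
      finally show ?thesis .
    qed
    then show "u *\<^sub>R f + v *\<^sub>R g \<in> dual_core B e 0"
      using a(1) b(1) unfolding dual_core_def
      by (auto simp: zero_cdual.rep_eq plus_cdual.rep_eq scaleR_cdual.rep_eq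
               intro!: exI[of _ "max a b"])
  qed
  then show "\<exists>V. open V \<and> 0 \<in> V \<and> V \<subseteq> U \<and>
      (\<forall>x\<in>V. \<forall>y\<in>V. \<forall>u\<ge>0. \<forall>v\<ge>0. u + v = 1 \<longrightarrow> u *\<^sub>R x + v *\<^sub>R y \<in> V)"
    unfolding convex_def
    using open_dual_core[OF Be(1)] dual_core_self[OF Be(2)] subset_trans[OF dual_core_subset Be(3)]
    by (intro exI[of _ "dual_core B e 0"] conjI)
qed

section \<open>Weak topologies and the canonical embedding into the bidual\<close>

definition weak_topology :: "'a::locally_convex_space topology" where
  "weak_topology = topology_generated_by {dual_apply f -` U | f U. open U}"

text \<open>On \<^typ>\<open>'b cdual\<close> this is \<open>\<sigma>(E\<^sup>*, E)\<close> for \<open>E = 'b\<close>; at \<open>'b = 'a cdual\<close> it is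
  \<open>\<sigma>(E\<^sup>*\<^sup>*, E\<^sup>*)\<close> for \<open>E = 'a\<close>.\<close>

definition weak_star_topology :: "'b::locally_convex_space cdual topology" where
  "weak_star_topology = topology_generated_by {(\<lambda>\<phi>. dual_apply \<phi> y) -` U | y U. open U}"

lift_definition canonical_embedding :: "'a::locally_convex_space \<Rightarrow> 'a cdual cdual"
  is "\<lambda>x f. dual_apply f x"
proof -
  fix x :: 'a
  have "linear (\<lambda>f. dual_apply f x)"
    by (simp add: linear_iff plus_cdual.rep_eq scaleR_cdual.rep_eq)
  moreover have "((\<lambda>f. dual_apply f x) \<longlongrightarrow> dual_apply g x) (nhds g)" for g :: "'a cdual"
  proof (rule tendstoI)
    fix e :: real assume "e > 0"
    then show "eventually (\<lambda>f. dist (dual_apply f x) (dual_apply g x) < e) (nhds g)"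
      using eventually_dual_nbhd[OF tvs_bounded_singleton, of e x g]
      by (simp add: dual_nbhd_def dist_real_def)
  qed
  then have "continuous_on UNIV (\<lambda>f. dual_apply f x)"
    by (simp add: continuous_on_def tendsto_mono[OF at_within_le_nhds])
  ultimately show "linear (\<lambda>f. dual_apply f x) \<and> continuous_on UNIV (\<lambda>f. dual_apply f x)"
    by blast
qed

definition bidual_closure :: "'a::locally_convex_space set \<Rightarrow> 'a cdual cdual set" where
  "bidual_closure C = weak_star_topology closure_of (canonical_embedding ` C)"

section \<open>Denting points, points of continuity, strongly extreme points\<close>

definition DP :: "'a::locally_convex_space set \<Rightarrow> 'a set" where
  "DP C = {x \<in> C. \<forall>U \<in> nbhds_of euclidean x. x \<notin> closure (convex hull (C - U))}"

definition bDP :: "'a::locally_convex_space set \<Rightarrow> 'a set" where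
  "bDP C = {x \<in> DP C. \<exists>W \<in> nbhds_of weak_topology x. tvs_bounded (W \<inter> C)}"

definition PC :: "'a::locally_convex_space set \<Rightarrow> 'a set" where
  "PC C = {x \<in> C. \<forall>U \<in> nbhds_of euclidean x. \<exists>W \<in> nbhds_of weak_topology x. W \<inter> C \<subseteq> U}"

definition bPC :: "'a::locally_convex_space set \<Rightarrow> 'a set" where
  "bPC C = {x \<in> PC C. \<exists>W \<in> nbhds_of weak_topology x. tvs_bounded (W \<inter> C)}"

definition directed_set :: "'i set \<Rightarrow> ('i \<Rightarrow> 'i \<Rightarrow> bool) \<Rightarrow> bool" where
  "directed_set \<Gamma> le \<longleftrightarrow> \<Gamma> \<noteq> {} \<and> reflp_on \<Gamma> le \<and> transp_on \<Gamma> le \<and>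
    (\<forall>i\<in>\<Gamma>. \<forall>j\<in>\<Gamma>. \<exists>k\<in>\<Gamma>. le i k \<and> le j k)"

definition net_lim ::
    "'a topology \<Rightarrow> 'i set \<Rightarrow> ('i \<Rightarrow> 'i \<Rightarrow> bool) \<Rightarrow> ('i \<Rightarrow> 'a) \<Rightarrow> 'a \<Rightarrow> bool" where
  "net_lim T \<Gamma> le c x \<longleftrightarrow> (\<forall>W \<in> nbhds_of T x. \<exists>i\<in>\<Gamma>. \<forall>j\<in>\<Gamma>. le i j \<longrightarrow> c j \<in> W)"

text \<open>A definition cannot quantify over the types from which index sets of nets are drawn. Index
  sets contained in the type \<^typ>\<open>'a set\<close> suffice: by \<open>weak_s_ext_net\<close> below, the condition then
  holds for nets over directed sets in any type.\<close>

definition weak_s_ext :: "'a::locally_convex_space set \<Rightarrow> 'a set" where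
  "weak_s_ext C = {x \<in> C. \<forall>(\<Gamma> :: 'a set set) le c c'.
    directed_set \<Gamma> le \<longrightarrow> c \<in> \<Gamma> \<rightarrow> C \<longrightarrow> c' \<in> \<Gamma> \<rightarrow> C \<longrightarrow>
    net_lim euclidean \<Gamma> le (\<lambda>i. (c i + c' i) /\<^sub>R 2) x \<longrightarrow> net_lim weak_topology \<Gamma> le c x}"

lemma weak_s_ext_net:
  fixes \<Gamma> :: "'i set" and C :: "'a::locally_convex_space set"
  assumes x: "x \<in> weak_s_ext C" and dir: "directed_set \<Gamma> le"
    and c: "c \<in> \<Gamma> \<rightarrow> C" and c': "c' \<in> \<Gamma> \<rightarrow> C"
    and lim: "net_lim euclidean \<Gamma> le (\<lambda>i. (c i + c' i) /\<^sub>R 2) x"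
  shows "net_lim weak_topology \<Gamma> le c x"
proof (rule ccontr)
  assume "\<not> net_lim weak_topology \<Gamma> le c x"
  then obtain W where W: "W \<in> nbhds_of weak_topology x"
      "\<And>i. i \<in> \<Gamma> \<Longrightarrow> \<exists>j\<in>\<Gamma>. le i j \<and> c j \<notin> W"
    unfolding net_lim_def by blast
  let ?N = "nbhds_of euclidean x"
  have "\<exists>j\<in>\<Gamma>. (c j + c' j) /\<^sub>R 2 \<in> U \<and> c j \<notin> W" if "U \<in> ?N" for U
    using lim that W(2) unfolding net_lim_def by blast
  then obtain s where s: "\<And>U. U \<in> ?N \<Longrightarrow> s U \<in> \<Gamma>"
      "\<And>U. U \<in> ?N \<Longrightarrow> (c (s U) + c' (s U)) /\<^sub>R 2 \<in> U" "\<And>U. U \<in> ?N \<Longrightarrow> c (s U) \<notin> W"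
    by metis
  have UN: "UNIV \<in> ?N" by (auto simp: nbhds_of_def)
  have Int: "U \<inter> V \<in> ?N" if UV: "U \<in> ?N" "V \<in> ?N" for U V
  proof -
    obtain U' V' where "open U'" "x \<in> U'" "U' \<subseteq> U" "open V'" "x \<in> V'" "V' \<subseteq> V"
      using UV by (auto simp: nbhds_of_def)
    then show ?thesis unfolding nbhds_of_def by (auto intro!: exI[of _ "U' \<inter> V'"])
  qed
  have "directed_set ?N (\<lambda>U V. V \<subseteq> U)"
    unfolding directed_set_def reflp_on_def transp_on_def
  proof (intro conjI ballI)
    show "\<exists>k\<in>?N. k \<subseteq> i \<and> k \<subseteq> j" if "i \<in> ?N" "j \<in> ?N" for i j
      using Int[OF that] by blast
  qed (use UN in auto)
  moreover have "(\<lambda>U. c (s U)) \<in> ?N \<rightarrow> C" "(\<lambda>U. c' (s U)) \<in> ?N \<rightarrow> C"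
    using s(1) c c' by auto
  moreover have "net_lim euclidean ?N (\<lambda>U V. V \<subseteq> U) (\<lambda>U. (c (s U) + c' (s U)) /\<^sub>R 2) x"
    using s(2) unfolding net_lim_def by blast
  ultimately have "net_lim weak_topology ?N (\<lambda>U V. V \<subseteq> U) (\<lambda>U. c (s U)) x"
    using x unfolding weak_s_ext_def by blast
  then show False
    using W(1) s(3) unfolding net_lim_def by blast
qed

definition ext_points :: "'a::real_vector set \<Rightarrow> 'a set" where
  "ext_points D = {x \<in> D. \<forall>d1\<in>D. \<forall>d2\<in>D. x = (d1 + d2) /\<^sub>R 2 \<longrightarrow> x = d1 \<and> x = d2}"

end

theory Submission
  imports Defs
begin

text \<open>A denting point has arbitrarily small slices around it, by Hahn--Banach; if the midpoint of two
  points of \<open>C\<close> is near \<open>x\<close>, one of them lies in such a slice, so both are near \<open>x\<close>. If \<open>x\<close> is the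
  midpoint of \<open>d\<^sub>1\<close>, \<open>d\<^sub>2\<close> in the bidual closure, approximating these by points of \<open>C\<close> gives midpoints that
  converge to \<open>x\<close> weakly, hence strongly at a point of continuity, and strong extremality yields \<open>d\<^sub>1 = x\<close>.

  For the return from extreme points to denting points, take a bounded weak neighbourhood of \<open>x\<close> in \<open>C\<close>
  inside \<open>U\<close>, cut out by finitely many functionals. Points of \<open>C - U\<close> are pulled along segments towards \<open>x\<close>
  onto its boundary, which is covered by finitely many bounded convex pieces; this moves convex
  combinations only closer to \<open>x\<close>. In a convex combination of the pieces some piece has weight bounded
  below, so if such combinations approached \<open>x\<close>, weak* compactness would exhibit \<open>x\<close> as a nontrivial
  convex combination in the bidual closure.\<close>

section \<open>Weak neighbourhoods and the bidual closure\<close>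

lemma linear_dual_apply: "linear (dual_apply f)"
  using dual_apply[of f] by simp

lemmas dual_apply_add = linear_add[OF linear_dual_apply]
  and dual_apply_diff = linear_diff[OF linear_dual_apply]
  and dual_apply_scaleR = linear_cmul[OF linear_dual_apply]

lemma continuous_on_dual_apply: "continuous_on S (dual_apply f)"
  using dual_apply[of f] continuous_on_subset by auto

lemma nbhds_of_euclidean: "U \<in> nbhds_of euclidean x \<longleftrightarrow> (\<exists>V. open V \<and> x \<in> V \<and> V \<subseteq> U)"
  by (simp add: nbhds_of_def)

lemma nbhds_of_Int:
  "U \<in> nbhds_of T x \<Longrightarrow> V \<in> nbhds_of T x \<Longrightarrow> U \<inter> V \<in> nbhds_of T x"
proof -
  assume "U \<in> nbhds_of T x" "V \<in> nbhds_of T x"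
  then obtain U' V' where "openin T U'" "x \<in> U'" "U' \<subseteq> U" "openin T V'" "x \<in> V'" "V' \<subseteq> V"
    by (auto simp: nbhds_of_def)
  then have "openin T (U' \<inter> V')" "x \<in> U' \<inter> V'" "U' \<inter> V' \<subseteq> U \<inter> V" by auto
  then show ?thesis unfolding nbhds_of_def by blast
qed

text \<open>The weak and the weak* topology are both generated by preimages under a family of real
  functions, so one description of neighbourhoods serves twice. Induction over the generation of an
  open set finds a basic neighbourhood of the fixed point \<open>x\<close> inside it.\<close>

lemma nbhds_of_initial_topology:
  fixes a :: "'i \<Rightarrow> 'p \<Rightarrow> real"
  shows "U \<in> nbhds_of (topology_generated_by {a i -` V | i V. open V}) x \<longleftrightarrow>
    (\<exists>F e. finite F \<and> e > 0 \<and> {y. \<forall>i\<in>F. \<bar>a i y - a i x\<bar> < e} \<subseteq> U)"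
    (is "U \<in> nbhds_of (topology_generated_by ?S) x \<longleftrightarrow> ?R U")
proof
  assume "U \<in> nbhds_of (topology_generated_by ?S) x"
  then obtain V where V: "generate_topology_on ?S V" "x \<in> V" "V \<subseteq> U"
    by (auto simp: nbhds_of_def openin_topology_generated_by_iff)
  have "?R V" using V(1,2)
  proof induction
    case (Int V W)
    then obtain F e G d where "finite F" "e > 0" "{y. \<forall>i\<in>F. \<bar>a i y - a i x\<bar> < e} \<subseteq> V"
      "finite G" "d > 0" "{y. \<forall>i\<in>G. \<bar>a i y - a i x\<bar> < d} \<subseteq> W" by auto
    then show ?case
      by (intro exI[of _ "F \<union> G"] exI[of _ "min e d"]) auto
  next
    case (UN K)
    then obtain V where "V \<in> K" "x \<in> V" by blast
    then have "?R V" by (rule UN.IH)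
    then show ?case using \<open>V \<in> K\<close> by (meson Union_upper subset_trans)
  next
    case (Basis V)
    then obtain i W where W: "V = a i -` W" "open W" by auto
    then obtain e where "e > 0" "\<And>r. \<bar>r - a i x\<bar> < e \<Longrightarrow> r \<in> W"
      using Basis.prems by (auto simp: open_dist dist_real_def)
    then show ?case
      using W by (intro exI[of _ "{i}"] exI[of _ e]) auto
  qed auto
  then show "?R U" using V(3) by (meson subset_trans)
next
  assume "?R U"
  then obtain F e where F: "finite F" "e > 0" "{y. \<forall>i\<in>F. \<bar>a i y - a i x\<bar> < e} \<subseteq> U" by blast
  have "generate_topology_on ?S {y. \<forall>i\<in>F. \<bar>a i y - a i x\<bar> < e}" using F(1)
  proof induction
    case empty
    \<comment> \<open>No conditions leave the whole space, which is open as the preimage of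
      \<open>UNIV\<close> under any \<open>a i\<close>.\<close>
    have "a i -` UNIV \<in> ?S" for i by blast
    then show ?case using generate_topology_on.Basis[of UNIV ?S] by simp
  next
    case (insert i F)
    have "{y. \<forall>j\<in>insert i F. \<bar>a j y - a j x\<bar> < e}
        = a i -` ball (a i x) e \<inter> {y. \<forall>j\<in>F. \<bar>a j y - a j x\<bar> < e}"
      by (auto simp: dist_real_def abs_minus_commute)
    moreover have "generate_topology_on ?S (a i -` ball (a i x) e)"
      by (rule generate_topology_on.Basis) blast
    ultimately show ?case using insert.IH by (simp add: generate_topology_on.Int)
  qed
  then show "U \<in> nbhds_of (topology_generated_by ?S) x"
    using F by (auto simp: nbhds_of_def openin_topology_generated_by_iff
      intro!: exI[of _ "{y. \<forall>i\<in>F. \<bar>a i y - a i x\<bar> < e}"])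
qed

definition weak_ball :: "'a::locally_convex_space cdual set \<Rightarrow> real \<Rightarrow> 'a \<Rightarrow> 'a set" where
  "weak_ball F e x = {y. \<forall>f\<in>F. \<bar>dual_apply f y - dual_apply f x\<bar> < e}"

lemma nbhds_of_weak:
  "W \<in> nbhds_of weak_topology x \<longleftrightarrow> (\<exists>F e. finite F \<and> e > 0 \<and> weak_ball F e x \<subseteq> W)"
  unfolding weak_topology_def weak_ball_def by (rule nbhds_of_initial_topology)

lemma open_weak_ball:
  assumes "finite F"
  shows "open (weak_ball F e x)"
proof -
  have "open {y. \<bar>dual_apply f y - dual_apply f x\<bar> < e}" for f
    by (intro open_Collect_less continuous_intros continuous_on_dual_apply)
  then have "open (\<Inter>f\<in>F. {y. \<bar>dual_apply f y - dual_apply f x\<bar> < e})"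
    using assms by blast
  then show ?thesis by (simp add: weak_ball_def Collect_ball_eq)
qed

lemma weak_ball_nbhd: "finite F \<Longrightarrow> e > 0 \<Longrightarrow> weak_ball F e x \<in> nbhds_of euclidean x"
  unfolding nbhds_of_euclidean
  by (intro exI[of _ "weak_ball F e x"] conjI open_weak_ball) (auto simp: weak_ball_def)

text \<open>Turns weak* closure into approximation at finitely many functionals, so that arguments
  in the bidual become estimates at points of \<open>C\<close>.\<close>

lemma bidual_closure_iff:
  "\<phi> \<in> bidual_closure C \<longleftrightarrow>
    (\<forall>F e. finite F \<longrightarrow> e > 0 \<longrightarrow> (\<exists>c\<in>C. \<forall>f\<in>F. \<bar>dual_apply f c - dual_apply \<phi> f\<bar> < e))"
proof -
  let ?T = "weak_star_topology :: 'a cdual cdual topology"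
  let ?B = "\<lambda>F e. {\<psi>. \<forall>f\<in>F. \<bar>dual_apply \<psi> f - dual_apply \<phi> f\<bar> < e}"
  have nbhds: "U \<in> nbhds_of ?T \<phi> \<longleftrightarrow> (\<exists>F e. finite F \<and> e > 0 \<and> ?B F e \<subseteq> U)" for U
    unfolding weak_star_topology_def by (rule nbhds_of_initial_topology)
  have "\<phi> \<in> topspace ?T"
  proof -
    have "(\<lambda>\<psi>. dual_apply \<psi> y) -` UNIV \<in> {(\<lambda>\<psi>. dual_apply \<psi> y) -` U | y U. open U}" for y :: "'a cdual"
      by blast
    then show ?thesis unfolding weak_star_topology_def topology_generated_by_topspace by auto
  qed
  then have "\<phi> \<in> bidual_closure C \<longleftrightarrow>
      (\<forall>U. openin ?T U \<and> \<phi> \<in> U \<longrightarrow> (\<exists>c\<in>C. canonical_embedding c \<in> U))"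
    unfolding bidual_closure_def in_closure_of by blast
  also have "\<dots> \<longleftrightarrow> (\<forall>U\<in>nbhds_of ?T \<phi>. \<exists>c\<in>C. canonical_embedding c \<in> U)"
    unfolding nbhds_of_def by blast
  also have "\<dots> \<longleftrightarrow> (\<forall>F e. finite F \<longrightarrow> e > 0 \<longrightarrow> (\<exists>c\<in>C. canonical_embedding c \<in> ?B F e))"
    (is "?L \<longleftrightarrow> ?R")
  proof
    assume ?L
    moreover have "?B F e \<in> nbhds_of ?T \<phi>" if "finite F" "e > 0" for F e
      unfolding nbhds using that by blast
    ultimately show ?R by blast
  next
    assume R: ?R
    show ?L
    proof
      fix U assume "U \<in> nbhds_of ?T \<phi>"
      then obtain F e where F: "finite F" "e > 0" "?B F e \<subseteq> U" unfolding nbhds by blast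
      then show "\<exists>c\<in>C. canonical_embedding c \<in> U" using R by (meson subsetD)
    qed
  qed
  finally show ?thesis by (simp add: canonical_embedding.rep_eq)
qed

lemma bidual_closure_mono: "A \<subseteq> B \<Longrightarrow> bidual_closure A \<subseteq> bidual_closure B"
  unfolding bidual_closure_def by (intro closure_of_mono image_mono)

text \<open>Approximants of \<phi> and \<psi> on the same \<open>F\<close> combine with the same
  weights, and the error stays below the same \<open>e\<close>.\<close>

lemma convex_bidual_closure:
  assumes "convex C"
  shows "convex (bidual_closure C)"
  unfolding convex_def
proof (intro ballI allI impI)
  fix \<phi> \<psi> :: "'a cdual cdual" and u v :: real
  assume in_cl: "\<phi> \<in> bidual_closure C" "\<psi> \<in> bidual_closure C" and uv: "0 \<le> u" "0 \<le> v" "u + v = 1"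
  show "u *\<^sub>R \<phi> + v *\<^sub>R \<psi> \<in> bidual_closure C"
    unfolding bidual_closure_iff
  proof (intro allI impI)
    fix F :: "'a cdual set" and e :: real assume F: "finite F" "e > 0"
    obtain c d where c: "c \<in> C" "\<And>f. f \<in> F \<Longrightarrow> \<bar>dual_apply f c - dual_apply \<phi> f\<bar> < e"
      and d: "d \<in> C" "\<And>f. f \<in> F \<Longrightarrow> \<bar>dual_apply f d - dual_apply \<psi> f\<bar> < e"
      using in_cl F unfolding bidual_closure_iff by metis
    have "\<bar>dual_apply f (u *\<^sub>R c + v *\<^sub>R d) - dual_apply (u *\<^sub>R \<phi> + v *\<^sub>R \<psi>) f\<bar> < e" if "f \<in> F" for f
    proof -
      have "dual_apply f (u *\<^sub>R c + v *\<^sub>R d) - dual_apply (u *\<^sub>R \<phi> + v *\<^sub>R \<psi>) f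
          = u * (dual_apply f c - dual_apply \<phi> f) + v * (dual_apply f d - dual_apply \<psi> f)"
        by (simp add: dual_apply_add dual_apply_scaleR plus_cdual.rep_eq scaleR_cdual.rep_eq algebra_simps)
      also have "\<bar>\<dots>\<bar> < e"
        using convex_bound_lt[of "\<bar>dual_apply f c - dual_apply \<phi> f\<bar>" e "\<bar>dual_apply f d - dual_apply \<psi> f\<bar>" u v]
          c(2)[OF that] d(2)[OF that] uv
        by (intro le_less_trans[OF abs_triangle_ineq]) (simp add: abs_mult)
      finally show ?thesis .
    qed
    moreover have "u *\<^sub>R c + v *\<^sub>R d \<in> C"
      using assms c(1) d(1) uv by (auto simp: convex_def)
    ultimately show "\<exists>c\<in>C. \<forall>f\<in>F. \<bar>dual_apply f c - dual_apply (u *\<^sub>R \<phi> + v *\<^sub>R \<psi>) f\<bar> < e"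
      by blast
  qed
qed

lemma weak_s_ext_iff:
  fixes C :: "'a::locally_convex_space set"
  shows "x \<in> weak_s_ext C \<longleftrightarrow> x \<in> C \<and> (\<forall>W\<in>nbhds_of weak_topology x. \<exists>U\<in>nbhds_of euclidean x.
    \<forall>c\<in>C. \<forall>c'\<in>C. (c + c') /\<^sub>R 2 \<in> U \<longrightarrow> c \<in> W)" (is "_ \<longleftrightarrow> _ \<and> ?R")
proof (intro iffI conjI)
  assume x: "x \<in> weak_s_ext C"
  then show "x \<in> C" by (simp add: weak_s_ext_def)
  show ?R
  proof (rule ccontr)
    let ?N = "nbhds_of euclidean x"
    assume "\<not> ?R"
    then obtain W where W: "W \<in> nbhds_of weak_topology x"
      "\<not> (\<exists>U\<in>?N. \<forall>c\<in>C. \<forall>c'\<in>C. (c + c') /\<^sub>R 2 \<in> U \<longrightarrow> c \<in> W)" by auto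
    then have "\<exists>p\<in>C \<times> C. (fst p + snd p) /\<^sub>R 2 \<in> U \<and> fst p \<notin> W" if "U \<in> ?N" for U
      using that by auto
    then obtain p where p: "\<And>U. U \<in> ?N \<Longrightarrow> p U \<in> C \<times> C"
      "\<And>U. U \<in> ?N \<Longrightarrow> (fst (p U) + snd (p U)) /\<^sub>R 2 \<in> U" "\<And>U. U \<in> ?N \<Longrightarrow> fst (p U) \<notin> W"
      by metis
    define c c' where "c U = fst (p U)" and "c' U = snd (p U)" for U
    have c: "\<And>U. U \<in> ?N \<Longrightarrow> c U \<in> C" "\<And>U. U \<in> ?N \<Longrightarrow> c' U \<in> C"
      "\<And>U. U \<in> ?N \<Longrightarrow> (c U + c' U) /\<^sub>R 2 \<in> U" "\<And>U. U \<in> ?N \<Longrightarrow> c U \<notin> W"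
      using p by (auto simp: c_def c'_def mem_Times_iff)
    have UN: "UNIV \<in> ?N" by (auto simp: nbhds_of_def)
    have "directed_set ?N (\<lambda>U V. V \<subseteq> U)"
      unfolding directed_set_def reflp_on_def transp_on_def
    proof (intro conjI ballI)
      show "\<exists>k\<in>?N. k \<subseteq> i \<and> k \<subseteq> j" if "i \<in> ?N" "j \<in> ?N" for i j
        using nbhds_of_Int[OF that] by blast
    qed (use UN in auto)
    moreover have "net_lim euclidean ?N (\<lambda>U V. V \<subseteq> U) (\<lambda>U. (c U + c' U) /\<^sub>R 2) x"
      using c(3) unfolding net_lim_def by blast
    ultimately have "net_lim weak_topology ?N (\<lambda>U V. V \<subseteq> U) c x"
      using c(1,2) by (intro weak_s_ext_net[OF x]) auto
    then show False
      using W(1) c(4) unfolding net_lim_def by blast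
  qed
next
  assume x: "x \<in> C \<and> ?R"
  show "x \<in> weak_s_ext C"
    unfolding weak_s_ext_def
  proof (intro CollectI conjI allI impI)
    fix \<Gamma> :: "'a set set" and le c c'
    assume c: "c \<in> \<Gamma> \<rightarrow> C" "c' \<in> \<Gamma> \<rightarrow> C"
      and lim: "net_lim euclidean \<Gamma> le (\<lambda>i. (c i + c' i) /\<^sub>R 2) x"
    show "net_lim weak_topology \<Gamma> le c x"
      unfolding net_lim_def
    proof
      fix W :: "'a set" assume "W \<in> nbhds_of weak_topology x"
      then obtain U where U: "U \<in> nbhds_of euclidean x"
        "\<And>c c'. c \<in> C \<Longrightarrow> c' \<in> C \<Longrightarrow> (c + c') /\<^sub>R 2 \<in> U \<Longrightarrow> c \<in> W"
        using x by blast
      obtain i where "i \<in> \<Gamma>" "\<And>j. j \<in> \<Gamma> \<Longrightarrow> le i j \<Longrightarrow> (c j + c' j) /\<^sub>R 2 \<in> U"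
        using lim U(1) unfolding net_lim_def by blast
      then show "\<exists>i\<in>\<Gamma>. \<forall>j\<in>\<Gamma>. le i j \<longrightarrow> c j \<in> W"
        using U(2) c by (intro bexI[of _ i] ballI impI) (auto simp: Pi_iff)
    qed
  qed (use x in blast)
qed

section \<open>Hahn--Banach separation\<close>

definition sublinear :: "('a::real_vector \<Rightarrow> real) \<Rightarrow> bool" where
  "sublinear p \<longleftrightarrow> (\<forall>x y. p (x + y) \<le> p x + p y) \<and> (\<forall>c\<ge>0. \<forall>x. p (c *\<^sub>R x) = c * p x)"

lemma sublinear_add: "sublinear p \<Longrightarrow> p (x + y) \<le> p x + p y"
  and sublinear_scaleR: "sublinear p \<Longrightarrow> c \<ge> 0 \<Longrightarrow> p (c *\<^sub>R x) = c * p x"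
  by (auto simp: sublinear_def)

lemma sublinear_0: "sublinear p \<Longrightarrow> p 0 = 0"
  using sublinear_scaleR[of p 0] by simp

lemma sublinear_minus: "sublinear p \<Longrightarrow> - p (- x) \<le> p x"
  using sublinear_add[of p x "- x"] by (simp add: sublinear_0)

text \<open>Applied to \<open>inverse c\<close> and \<open>c *\<^sub>R x\<close>, the inequality
  \<open>le\<close> yields its own reverse.\<close>

lemma sublinearI:
  assumes add: "\<And>x y. p (x + y) \<le> p x + p y" and "p 0 = 0"
    and le: "\<And>c x. c > 0 \<Longrightarrow> p (c *\<^sub>R x) \<le> c * p x"
  shows "sublinear p"
  unfolding sublinear_def
proof (intro conjI allI impI add)
  fix c :: real and x assume "c \<ge> 0"
  show "p (c *\<^sub>R x) = c * p x"
  proof (cases "c = 0")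
    case False
    with \<open>c \<ge> 0\<close> have c: "c > 0" by simp
    then have "p x \<le> inverse c * p (c *\<^sub>R x)"
      using le[of "inverse c" "c *\<^sub>R x"] by simp
    then have "c * p x \<le> p (c *\<^sub>R x)"
      using c by (simp add: field_simps)
    then show ?thesis using le[OF c, of x] by simp
  qed (simp add: \<open>p 0 = 0\<close>)
qed

text \<open>Take the infimum of \<open>p (x + t *\<^sub>R y) - t * p y\<close> over
  \<open>t \<ge> 0\<close>: \<open>t = 0\<close> bounds it by \<open>p\<close>, and
  \<open>t = 1\<close> at \<open>- y\<close> gives the last claim. This serves to prescribe a value
  at \<open>y\<close> and to show that minimal functionals are odd.\<close>

lemma sublinear_lower_direction:
  fixes p :: "'a::real_vector \<Rightarrow> real"
  assumes p: "sublinear p"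
  obtains q where "sublinear q" "\<And>x. q x \<le> p x" "q (- y) \<le> - p y"
proof -
  define v where "v x t = p (x + t *\<^sub>R y) - t * p y" for x and t :: real
  define q where "q x = (INF t\<in>{0..}. v x t)" for x
  have v_ge: "- p (- x) \<le> v x t" if "t \<ge> 0" for x t
    using sublinear_add[OF p, of "x + t *\<^sub>R y" "- x"] sublinear_scaleR[OF p that, of y]
    by (simp add: v_def)
  have bdd: "bdd_below (v x ` {0..})" for x
    using v_ge by (intro bdd_belowI[of _ "- p (- x)"]) auto
  have q_le: "q x \<le> v x t" if "t \<ge> 0" for x t
    unfolding q_def using that by (intro cINF_lower[OF bdd]) simp
  have q_ge: "r \<le> q x" if "\<And>t. t \<ge> 0 \<Longrightarrow> r \<le> v x t" for r x
    unfolding q_def using that by (intro cINF_greatest) auto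
  have "sublinear q"
  proof (rule sublinearI)
    fix x x'
    have "q (x + x') \<le> v x t + v x' t'" if "t \<ge> 0" "t' \<ge> 0" for t t'
    proof -
      have "q (x + x') \<le> v (x + x') (t + t')" using that by (intro q_le) simp
      also have "\<dots> \<le> v x t + v x' t'"
        using sublinear_add[OF p, of "x + t *\<^sub>R y" "x' + t' *\<^sub>R y"] by (simp add: v_def algebra_simps)
      finally show ?thesis .
    qed
    \<comment> \<open>The two infima are taken one at a time, first over \<open>t'\<close>, then
      over \<open>t\<close>.\<close>
    then have "q (x + x') - v x t \<le> q x'" if "t \<ge> 0" for t
      using that by (intro q_ge) (simp add: algebra_simps)
    then have "q (x + x') - q x' \<le> q x"
      by (intro q_ge) (simp add: algebra_simps)
    then show "q (x + x') \<le> q x + q x'" by simp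
  next
    have "v 0 t = 0" if "t \<ge> 0" for t
      using sublinear_scaleR[OF p that] by (simp add: v_def)
    then show "q 0 = 0"
      using q_le[of 0 0] q_ge[of 0 0] by simp
  next
    fix c :: real and x assume c: "c > 0"
    have "inverse c * q (c *\<^sub>R x) \<le> v x t" if "t \<ge> 0" for t
    proof -
      have "q (c *\<^sub>R x) \<le> v (c *\<^sub>R x) (c * t)" using c that by (intro q_le) simp
      also have "\<dots> = c * v x t"
        using sublinear_scaleR[OF p, of c "x + t *\<^sub>R y"] c by (simp add: v_def algebra_simps)
      finally show ?thesis using c by (simp add: field_simps)
    qed
    then have "inverse c * q (c *\<^sub>R x) \<le> q x" by (rule q_ge)
    then show "q (c *\<^sub>R x) \<le> c * q x" using c by (simp add: field_simps)
  qed
  moreover have "q x \<le> p x" for x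
    using q_le[of 0 x] by (simp add: v_def)
  moreover have "q (- y) \<le> - p y"
    using q_le[of 1 "- y"] by (simp add: v_def sublinear_0[OF p])
  ultimately show ?thesis by (rule that)
qed

text \<open>The minimal sublinear functionals are exactly the linear ones, so Hahn--Banach follows from Zorn's
  lemma without partially defined functionals.\<close>

lemma minimal_sublinear:
  fixes p :: "'a::real_vector \<Rightarrow> real"
  assumes p: "sublinear p"
  obtains m where "sublinear m" "m \<le> p" "\<And>q. sublinear q \<Longrightarrow> q \<le> m \<Longrightarrow> q = m"
proof -
  define A where "A = {q. sublinear q \<and> q \<le> p}"
  have "\<exists>m\<in>A. \<forall>a\<in>A. m \<ge> a \<longrightarrow> a = m"
  \<comment> \<open>The order is reversed, so a maximal element is a minimal functional, and a chain
    needs a lower bound: its pointwise infimum.\<close>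
  proof (rule predicate_Zorn)
    show "partial_order_on A (relation_of (\<ge>) A)"
      by (rule partial_order_on_relation_ofI) auto
  next
    fix K assume "K \<in> Chains (relation_of (\<ge>) A)"
    then have K: "K \<subseteq> A" and chain: "\<And>q r. q \<in> K \<Longrightarrow> r \<in> K \<Longrightarrow> q \<le> r \<or> r \<le> q"
      by (auto simp: Chains_def relation_of_def)
    show "\<exists>u\<in>A. \<forall>a\<in>K. a \<ge> u"
    proof (cases "K = {}")
      case True
      then show ?thesis using p by (auto simp: A_def)
    next
      case False
      define u where "u x = (INF q\<in>K. q x)" for x
      have "- p (- x) \<le> q x" if "q \<in> K" for q x
      proof -
        have "sublinear q" "q (- x) \<le> p (- x)" using that K by (auto simp: A_def le_fun_def)
        then show ?thesis using sublinear_minus[of q x] by simp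
      qed
      then have bdd: "bdd_below ((\<lambda>q. q x) ` K)" for x
        by (intro bdd_belowI[of _ "- p (- x)"]) auto
      have u_le: "u x \<le> q x" if "q \<in> K" for q x
        unfolding u_def using that by (intro cINF_lower[OF bdd])
      have u_ge: "r \<le> u x" if "\<And>q. q \<in> K \<Longrightarrow> r \<le> q x" for r x
        unfolding u_def using that False by (intro cINF_greatest) auto
      have sub: "sublinear q" if "q \<in> K" for q using that K by (auto simp: A_def)
      have "sublinear u"
      proof (rule sublinearI)
        fix x y
        have *: "u (x + y) \<le> q x + r y" if qr: "q \<in> K" "r \<in> K" for q r
        proof -
          \<comment> \<open>In a chain the smaller of \<open>q\<close> and \<open>r\<close> lies
            below both, and its own subadditivity gives the mixed bound.\<close>
          obtain s where s: "s \<in> K" "s \<le> q" "s \<le> r" using chain[OF qr] qr by blast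
          have "u (x + y) \<le> s x + s y"
            using u_le[OF s(1), of "x + y"] sublinear_add[OF sub[OF s(1)], of x y] by simp
          then show ?thesis using s(2,3) by (smt (verit) le_funD)
        qed
        have "u (x + y) - q x \<le> u y" if "q \<in> K" for q
          using *[OF that] by (intro u_ge) (simp add: algebra_simps)
        then have "u (x + y) - u y \<le> u x"
          by (intro u_ge) (simp add: algebra_simps)
        then show "u (x + y) \<le> u x + u y" by simp
      next
        have "q 0 = 0" if "q \<in> K" for q using sublinear_0[OF sub[OF that]] .
        then show "u 0 = 0" using u_le[of _ 0] u_ge[of 0 0] False by force
      next
        fix c :: real and x assume c: "c > 0"
        have "inverse c * u (c *\<^sub>R x) \<le> q x" if "q \<in> K" for q
          using u_le[OF that, of "c *\<^sub>R x"] sublinear_scaleR[OF sub[OF that], of c x] c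
          by (simp add: field_simps)
        then have "inverse c * u (c *\<^sub>R x) \<le> u x" by (rule u_ge)
        then show "u (c *\<^sub>R x) \<le> c * u x" using c by (simp add: field_simps)
      qed
      moreover have "u \<le> p"
      proof (rule le_funI)
        fix x
        obtain q where "q \<in> K" using False by blast
        then have "u x \<le> q x" "q x \<le> p x" using u_le K by (auto simp: A_def le_fun_def)
        then show "u x \<le> p x" by simp
      qed
      ultimately have "u \<in> A" by (simp add: A_def)
      then show ?thesis using u_le by (auto simp: le_fun_def)
    qed
  qed
  then obtain m where "m \<in> A" "\<And>q. q \<in> A \<Longrightarrow> q \<le> m \<Longrightarrow> q = m" by blast
  then show ?thesis
    using that[of m] by (auto simp: A_def dest: order_trans)
qed

text \<open>A minimal \<open>f\<close> below \<open>q\<close> satisfies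
  \<open>f (- y) \<le> - p y\<close>, which oddness turns into \<open>f y \<ge> p y\<close>.
  Subadditivity at \<open>- x\<close> and \<open>- z\<close> together with oddness makes
  \<open>f\<close> additive.\<close>

theorem Hahn_Banach_sublinear:
  fixes p :: "'a::real_vector \<Rightarrow> real"
  assumes p: "sublinear p"
  obtains f where "linear f" "\<And>x. f x \<le> p x" "f y = p y"
proof -
  obtain q where q: "sublinear q" "\<And>x. q x \<le> p x" "q (- y) \<le> - p y"
    using sublinear_lower_direction[OF p] by blast
  obtain f where f: "sublinear f" "f \<le> q" "\<And>r. sublinear r \<Longrightarrow> r \<le> f \<Longrightarrow> r = f"
    using minimal_sublinear[OF q(1)] by blast
  have odd: "f (- x) = - f x" for x
  proof -
    \<comment> \<open>Lowering a minimal functional in the direction \<open>x\<close> cannot change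
      it, so \<open>r\<close> is \<open>f\<close>.\<close>
    obtain r where r: "sublinear r" "\<And>z. r z \<le> f z" "r (- x) \<le> - f x"
      using sublinear_lower_direction[OF f(1)] by blast
    then have "r = f" using f(3) by (simp add: le_fun_def)
    then show ?thesis using r(3) sublinear_minus[OF f(1), of x] by simp
  qed
  have "linear f"
  proof (rule linearI)
    fix x z
    show "f (x + z) = f x + f z"
      using sublinear_add[OF f(1), of x z] sublinear_add[OF f(1), of "- x" "- z"] odd[of "x + z"]
      by (simp add: odd)
  next
    fix c :: real and x
    show "f (c *\<^sub>R x) = c *\<^sub>R f x"
      using sublinear_scaleR[OF f(1), of c x] sublinear_scaleR[OF f(1), of "- c" x] odd[of "c *\<^sub>R x"]
      by (cases "c \<ge> 0") auto
  qed
  moreover have "f x \<le> p x" for x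
    using f(2) q(2)[of x] by (meson le_funD order_trans)
  moreover have "f y = p y"
    using \<open>f y \<le> p y\<close> le_funD[OF f(2), of "- y"] q(3) odd[of y] by simp
  ultimately show ?thesis by (rule that)
qed

section \<open>The Minkowski functional of a convex absorbing set\<close>

definition gauge_functional :: "'a::real_vector set \<Rightarrow> 'a \<Rightarrow> real" where
  "gauge_functional G x = Inf {t. t > 0 \<and> x /\<^sub>R t \<in> G}"

lemma gauge_functional_le: "t > 0 \<Longrightarrow> x /\<^sub>R t \<in> G \<Longrightarrow> gauge_functional G x \<le> t"
  unfolding gauge_functional_def by (intro cInf_lower bdd_belowI[of _ 0]) auto

lemma gauge_functional_less:
  assumes "\<And>x. \<exists>t>0. x /\<^sub>R t \<in> G" "gauge_functional G x < r"
  obtains t where "t > 0" "x /\<^sub>R t \<in> G" "t < r"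
proof -
  have "{t. t > 0 \<and> x /\<^sub>R t \<in> G} \<noteq> {}" using assms(1) by blast
  then have "\<exists>t\<in>{t. t > 0 \<and> x /\<^sub>R t \<in> G}. t < r"
    using assms(2) unfolding gauge_functional_def by (rule cInf_lessD)
  then obtain t where "t \<in> {t. t > 0 \<and> x /\<^sub>R t \<in> G}" "t < r" by (rule bexE)
  then show ?thesis by (intro that[of t]) auto
qed

text \<open>If \<open>x /\<^sub>R s\<close> and \<open>y /\<^sub>R t\<close> lie in
  \<open>G\<close>, then \<open>(x + y) /\<^sub>R (s + t)\<close> is their convex combination with
  weights \<open>s / (s + t)\<close> and \<open>t / (s + t)\<close>. The slack \<open>e\<close>
  covers infima that are not attained.\<close>

lemma sublinear_gauge_functional:
  assumes G: "convex G" and abs: "\<And>x. \<exists>t>0. x /\<^sub>R t \<in> G"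
  shows "sublinear (gauge_functional G)"
proof (rule sublinearI)
  fix x y
  show "gauge_functional G (x + y) \<le> gauge_functional G x + gauge_functional G y"
  proof (rule field_le_epsilon)
    fix e :: real assume e: "e > 0"
    obtain s where s: "s > 0" "x /\<^sub>R s \<in> G" "s < gauge_functional G x + e/2"
      using gauge_functional_less[OF abs, where x = x and r = "gauge_functional G x + e/2"] e by auto
    obtain t where t: "t > 0" "y /\<^sub>R t \<in> G" "t < gauge_functional G y + e/2"
      using gauge_functional_less[OF abs, where x = y and r = "gauge_functional G y + e/2"] e by auto
    have "s / (s + t) + t / (s + t) = 1"
      using s t by (simp flip: add_divide_distrib)
    then have "(s / (s + t)) *\<^sub>R (x /\<^sub>R s) + (t / (s + t)) *\<^sub>R (y /\<^sub>R t) \<in> G"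
      using s t by (intro convexD[OF G]) auto
    moreover have "s / (s + t) * inverse s = inverse (s + t)" "t / (s + t) * inverse t = inverse (s + t)"
      using s(1) t(1) by (simp_all add: divide_inverse)
    ultimately have "(x + y) /\<^sub>R (s + t) \<in> G"
      by (simp add: scaleR_right_distrib del: times_divide_eq_left)
    then have "gauge_functional G (x + y) \<le> s + t"
      using s t by (intro gauge_functional_le) auto
    then show "gauge_functional G (x + y) \<le> gauge_functional G x + gauge_functional G y + e"
      using s t by linarith
  qed
next
  have "0 \<in> G" using abs[of 0] by simp
  show "gauge_functional G 0 = 0"
  proof (rule antisym)
    show "gauge_functional G 0 \<le> 0"
      by (rule field_le_epsilon) (simp add: gauge_functional_le \<open>0 \<in> G\<close>)
    show "0 \<le> gauge_functional G 0"
      unfolding gauge_functional_def using abs[of 0] by (intro cInf_greatest) auto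
  qed
next
  fix c :: real and x assume c: "c > 0"
  show "gauge_functional G (c *\<^sub>R x) \<le> c * gauge_functional G x"
  proof (rule field_le_epsilon)
    fix e :: real assume e: "e > 0"
    have "gauge_functional G x < gauge_functional G x + e/c" using e c by simp
    then obtain s where s: "s > 0" "x /\<^sub>R s \<in> G" "s < gauge_functional G x + e/c"
      using gauge_functional_less[OF abs] by blast
    have "(c *\<^sub>R x) /\<^sub>R (c * s) = x /\<^sub>R s"
      using c by (simp add: field_simps)
    then have "gauge_functional G (c *\<^sub>R x) \<le> c * s"
      using s c by (metis gauge_functional_le mult_pos_pos)
    also have "\<dots> \<le> c * (gauge_functional G x + e/c)"
      using s(3) c by simp
    also have "\<dots> = c * gauge_functional G x + e"
      using c by (simp add: distrib_left)
    finally show "gauge_functional G (c *\<^sub>R x) \<le> c * gauge_functional G x + e" .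
  qed
qed

text \<open>If \<open>x /\<^sub>R t\<close> were in \<open>G\<close> for some \<open>t < 1\<close>,
  then \<open>x\<close> would lie on the segment from 0 to it.\<close>

lemma gauge_functional_ge_1:
  assumes G: "convex G" and abs: "\<And>x. \<exists>t>0. x /\<^sub>R t \<in> G" and "x \<notin> G"
  shows "1 \<le> gauge_functional G x"
proof (rule ccontr)
  assume "\<not> 1 \<le> gauge_functional G x"
  then obtain t where t: "t > 0" "x /\<^sub>R t \<in> G" "t < 1"
    using gauge_functional_less[OF abs, where x = x and r = 1] by auto
  have "0 \<in> G" using abs[of 0] by simp
  then have "(1 - t) *\<^sub>R 0 + t *\<^sub>R (x /\<^sub>R t) \<in> G"
    using t by (intro convexD[OF G]) auto
  then show False using t \<open>x \<notin> G\<close> by simp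
qed

section \<open>Continuity and separation in locally convex spaces\<close>

lemma absorbing_open:
  fixes x :: "'a::locally_convex_space"
  assumes "open V" "0 \<in> V"
  shows "\<exists>t>0. x /\<^sub>R t \<in> V"
proof -
  have "V \<in> nbhds_of euclidean 0" using assms by (auto simp: nbhds_of_def)
  then obtain s where "s > 0" "\<forall>t>s. {x} \<subseteq> (\<lambda>u. t *\<^sub>R u) ` V"
    using tvs_boundedD[OF tvs_bounded_singleton] by blast
  then have "x \<in> (\<lambda>u. (s + 1) *\<^sub>R u) ` V" "s + 1 > 0" by auto
  then show ?thesis by (intro exI[of _ "s + 1"]) auto
qed

lemma continuous_on_scaleR_lcs: "continuous_on S (\<lambda>x::'a::locally_convex_space. c *\<^sub>R x)"
proof -
  have "((\<lambda>x. c *\<^sub>R x) \<longlongrightarrow> c *\<^sub>R y) (at y within S)" for y :: 'a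
    using filterlim_compose[OF tendsto_scaleR_Pair[of c y] filterlim_Pair[OF tendsto_const tendsto_ident_at]]
    by simp
  then show ?thesis by (simp add: continuous_on_def)
qed

text \<open>The bound on \<open>V\<close> is translated to \<open>x\<close> and scaled; the factor
  \<open>2/e\<close> instead of \<open>1/e\<close> leaves room for the strict inequality.\<close>

lemma continuous_linear_functional:
  fixes f :: "'a::locally_convex_space \<Rightarrow> real"
  assumes f: "linear f" and V: "open V" "0 \<in> V" and bound: "\<And>v. v \<in> V \<Longrightarrow> \<bar>f v\<bar> \<le> 1"
  shows "continuous_on UNIV f"
  unfolding continuous_on_def
proof (intro ballI tendstoI)
  fix x :: 'a and e :: real assume e: "e > 0"
  let ?h = "\<lambda>y. (2/e) *\<^sub>R (y - x)"
  have "continuous_on UNIV ?h"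
    by (intro continuous_on_compose2[OF continuous_on_scaleR_lcs[of UNIV]] continuous_on_diff
        continuous_on_id continuous_on_const) auto
  then have "open (?h -` V)" using V(1) by (simp add: open_vimage)
  moreover have "x \<in> ?h -` V" using V(2) by simp
  moreover have "dist (f y) (f x) < e" if "y \<in> ?h -` V" for y
  proof -
    have "\<bar>(2/e) * (f y - f x)\<bar> \<le> 1"
      using bound[of "?h y"] that linear_cmul[OF f] linear_diff[OF f] by simp
    then show ?thesis using e by (simp add: dist_real_def abs_mult field_simps)
  qed
  ultimately show "\<forall>\<^sub>F y in at x within UNIV. dist (f y) (f x) < e"
    unfolding eventually_at_topological by blast
qed

text \<open>\<open>G\<close> is \<open>A\<close> translated by \<open>- a0\<close> and thickened by
  a neighbourhood \<open>S\<close> of 0 so small that \<open>x - a0\<close> stays outside. Its gauge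
  is at least 1 there, and the Hahn--Banach functional attaining that value is at most 1 on
  \<open>G\<close>.\<close>

theorem separate_point_convex:
  fixes A :: "'a::locally_convex_space set"
  assumes A: "convex A" and x: "x \<notin> closure A"
  obtains f \<alpha> where "dual_apply f x > \<alpha>" "\<And>a. a \<in> A \<Longrightarrow> dual_apply f a \<le> \<alpha>"
proof (cases "A = {}")
  case True
  \<comment> \<open>For empty \<open>A\<close> the level -1 and the zero functional do.\<close>
  then show ?thesis using that[of "-1" 0] by (simp add: zero_cdual.rep_eq)
next
  case False
  then obtain a0 where a0: "a0 \<in> A" by blast
  have "continuous_on UNIV (\<lambda>v. x - v)"
    by (intro continuous_intros)
  then have "open ((\<lambda>v. x - v) -` (- closure A))"
    by (intro open_vimage) auto
  then obtain V where V: "open V" "0 \<in> V" "V \<subseteq> (\<lambda>v. x - v) -` (- closure A)" "convex V"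
    using locally_convex[of "(\<lambda>v. x - v) -` (- closure A)"] x by auto
  \<comment> \<open>Symmetry lets an upper bound for the functional on \<open>S\<close> bound its
    absolute value, which yields continuity.\<close>
  define S where "S = V \<inter> uminus ` V"
  have "uminus ` V = uminus -` V" by force
  moreover have "open (uminus -` V)"
    by (intro open_vimage V(1) continuous_on_minus continuous_on_id)
  ultimately have "open S"
    unfolding S_def using V(1) by auto
  have "0 \<in> S" using V(2) by (force simp: S_def)
  have "convex S" unfolding S_def by (intro convex_Int V(4) convex_negations)
  have S_sym: "- v \<in> S" if "v \<in> S" for v using that by (force simp: S_def)
  define G where "G = (\<Union>a\<in>A. \<Union>v\<in>S. {a - a0 + v})"
  have "G = (\<Union>y\<in>(\<lambda>a. a - a0) ` A. \<Union>v\<in>S. {y + v})" by (auto simp: G_def)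
  then have G: "convex G"
    using convex_sums[OF convex_translation_subtract[OF A, of a0] \<open>convex S\<close>] by simp
  have "S \<subseteq> G" using a0 by (force simp: G_def)
  then have abs: "\<exists>t>0. y /\<^sub>R t \<in> G" for y
    using absorbing_open[OF \<open>open S\<close> \<open>0 \<in> S\<close>] by blast
  have "x - a0 \<notin> G"
  proof
    assume "x - a0 \<in> G"
    then obtain a v where av: "a \<in> A" "v \<in> S" "x - a0 = a - a0 + v" by (auto simp: G_def)
    then have "x - v = a" by (simp add: algebra_simps)
    moreover have "x - v \<notin> closure A" using av(2) V(3) by (auto simp: S_def)
    ultimately show False using av(1) closure_subset[of A] by auto
  qed
  then have ge1: "1 \<le> gauge_functional G (x - a0)" by (rule gauge_functional_ge_1[OF G abs])
  obtain f where f: "linear f" "\<And>y. f y \<le> gauge_functional G y" "f (x - a0) = gauge_functional G (x - a0)"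
    using Hahn_Banach_sublinear[OF sublinear_gauge_functional[OF G abs]] by blast
  have f_le_1: "f y \<le> 1" if "y \<in> G" for y
    using f(2)[of y] gauge_functional_le[of 1 y G] that by simp
  have "\<bar>f v\<bar> \<le> 1" if "v \<in> S" for v
    using f_le_1[of v] f_le_1[of "- v"] S_sym[OF that] that \<open>S \<subseteq> G\<close> linear_neg[OF f(1), of v]
    by (auto simp: abs_le_iff)
  then have "continuous_on UNIV f"
    by (rule continuous_linear_functional[OF f(1) \<open>open S\<close> \<open>0 \<in> S\<close>])
  then have F: "dual_apply (Abs_cdual f) = f" using f(1) by (simp add: Abs_cdual_inverse)
  obtain t where t: "t > 0" "(x - a0) /\<^sub>R t \<in> S"
    using absorbing_open[OF \<open>open S\<close> \<open>0 \<in> S\<close>] by blast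
  \<comment> \<open>A positive multiple of \<open>x - a0\<close> inside \<open>S\<close>. Adding it
    to \<open>a - a0\<close> stays in \<open>G\<close>, so \<open>f v\<close> is a gap between
    \<open>f x\<close> and all values on \<open>A\<close>.\<close>
  define v where "v = (x - a0) /\<^sub>R t"
  have "f v > 0"
    using t(1) ge1 f(3) linear_cmul[OF f(1)] by (simp add: v_def)
  then have "f x - f v < dual_apply (Abs_cdual f) x" by (simp add: F)
  moreover have "dual_apply (Abs_cdual f) a \<le> f x - f v" if "a \<in> A" for a
  proof -
    have "f (a - a0 + v) \<le> 1" using that t(2) by (intro f_le_1) (auto simp: G_def v_def)
    then have "f (a - a0 + v) \<le> f (x - a0)" using ge1 f(3) by simp
    then show ?thesis by (simp add: F linear_add[OF f(1)] linear_diff[OF f(1)])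
  qed
  ultimately show ?thesis by (rule that)
qed

section \<open>Compactness and extreme points of the bidual closure\<close>

lemma convex_dual_apply_vimage: "convex S \<Longrightarrow> convex (dual_apply f -` S)"
  by (rule convex_linear_vimage[OF linear_dual_apply])

text \<open>The Banach--Alaoglu argument: \<open>B\<close> lies in a compact product of intervals, and pointwise limits
  of evaluations at points of \<open>B\<close> are linear and bounded on the polar of \<open>B\<close>.\<close>

lemma bidual_closure_cluster:
  fixes B :: "'a::locally_convex_space set"
  assumes B: "tvs_bounded B" and ne: "\<A> \<noteq> {}"
    and sub: "\<And>A. A \<in> \<A> \<Longrightarrow> A \<noteq> {} \<and> A \<subseteq> B"
    and dir: "\<And>A A'. A \<in> \<A> \<Longrightarrow> A' \<in> \<A> \<Longrightarrow> \<exists>A''\<in>\<A>. A'' \<subseteq> A \<inter> A'"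
  obtains \<phi> where "\<And>A. A \<in> \<A> \<Longrightarrow> \<phi> \<in> bidual_closure A"
proof -
  obtain M where M: "\<And>f x. x \<in> B \<Longrightarrow> \<bar>dual_apply f x\<bar> < M f"
    using bounded_dual_apply[OF B] by metis
  define ev where "ev x = (\<lambda>f. dual_apply f x)" for x :: 'a
  define P where "P = (\<Pi>\<^sub>E f\<in>UNIV. {- M f..M f})"
  have "compact P"
    using compactin_PiE[of "\<lambda>_. euclidean" UNIV "\<lambda>f. {- M f..M f}"]
    by (simp add: P_def euclidean_product_topology)
  \<comment> \<open>Directedness passes to finite subfamilies and gives the finite intersection
    property.\<close>
  have lower: "\<exists>A\<in>\<A>. A \<subseteq> \<Inter>I" if "finite I" "I \<subseteq> \<A>" for I
    using that
  proof induction
    case empty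
    then show ?case using ne by auto
  next
    case (insert A' I)
    then obtain A where "A \<in> \<A>" "A \<subseteq> \<Inter>I" by auto
    moreover then obtain A'' where "A'' \<in> \<A>" "A'' \<subseteq> A' \<inter> A" using dir insert.prems by blast
    ultimately show ?case by blast
  qed
  have "P \<inter> (\<Inter>A\<in>\<A>. closure (ev ` A)) \<noteq> {}"
  proof (rule compact_imp_fip_image[OF \<open>compact P\<close>])
    fix I assume I: "finite I" "I \<subseteq> \<A>"
    then obtain A where A: "A \<in> \<A>" "A \<subseteq> \<Inter>I" using lower by blast
    then obtain x where x: "x \<in> A" "x \<in> B" using sub by blast
    have "ev x \<in> closure (ev ` A')" if "A' \<in> I" for A'
      using that x(1) A(2) closure_subset[of "ev ` A'"] by blast
    moreover have "\<bar>dual_apply f x\<bar> \<le> M f" for f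
      using M[OF x(2), of f] by simp
    then have "ev x \<in> P"
      by (auto simp: P_def ev_def abs_le_iff minus_le_iff)
    ultimately show "P \<inter> (\<Inter>A'\<in>I. closure (ev ` A')) \<noteq> {}" by blast
  qed simp
  then obtain h where h: "\<And>A. A \<in> \<A> \<Longrightarrow> h \<in> closure (ev ` A)" by blast
  \<comment> \<open>Closed conditions satisfied by all evaluations at points of \<open>B\<close>
    pass to \<open>h\<close>; linearity and the bound on the polar are obtained this way.\<close>
  have h_in: "h \<in> S" if "closed S" "\<And>x. x \<in> B \<Longrightarrow> ev x \<in> S" for S
  proof -
    obtain A where A: "A \<in> \<A>" using ne by blast
    then have "closure (ev ` A) \<subseteq> S" using that sub by (intro closure_minimal) blast+
    then show ?thesis using h[OF A] by blast
  qed
  have cont: "continuous_on UNIV (\<lambda>g::'a cdual \<Rightarrow> real. g f)" for f by simp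
  have "linear h"
  proof (rule linearI)
    fix f g
    have "h \<in> {k. k (f + g) = k f + k g}"
      by (rule h_in) (auto intro!: closed_Collect_eq continuous_on_add cont simp: ev_def plus_cdual.rep_eq)
    then show "h (f + g) = h f + h g" by simp
  next
    fix c f
    have "h \<in> {k. k (c *\<^sub>R f) = c * k f}"
      by (rule h_in) (auto intro!: closed_Collect_eq continuous_on_mult_left cont simp: ev_def scaleR_cdual.rep_eq)
    then show "h (c *\<^sub>R f) = c *\<^sub>R h f" by simp
  qed
  moreover have "\<bar>h f\<bar> \<le> 1" if "f \<in> dual_core B 1 0" for f
  proof -
    have bound: "\<bar>dual_apply f x\<bar> \<le> 1" if "x \<in> B" for x
      using that \<open>f \<in> dual_core B 1 0\<close> by (force simp: dual_core_def zero_cdual.rep_eq)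
    have "h \<in> {k. \<bar>k f\<bar> \<le> 1}"
      by (rule h_in) (auto intro!: closed_Collect_le continuous_on_rabs continuous_on_const cont
          simp: ev_def bound)
    then show ?thesis by simp
  qed
  ultimately have "dual_apply (Abs_cdual h) = h"
    using continuous_linear_functional[of h "dual_core B 1 0"] open_dual_core[OF B] dual_core_self[of 1 0 B]
    by (simp add: Abs_cdual_inverse)
  \<comment> \<open>Finitely many coordinates with tolerance \<open>e\<close> give an open set of
    the product, so pointwise closure yields weak* approximation.\<close>
  moreover have "\<exists>x\<in>A. \<forall>f\<in>F. \<bar>dual_apply f x - h f\<bar> < e" if A: "A \<in> \<A>" and F: "finite F" "e > 0" for A F e
  proof -
    let ?N = "{k. \<forall>f\<in>F. k f \<in> ball (h f) e}"
    have "open ?N"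
      by (rule product_topology_basis'[of F "\<lambda>f. ball (h f) e" "\<lambda>f. f"]) (use F in auto)
    moreover have "h \<in> ?N" using F by simp
    ultimately have "?N \<inter> ev ` A \<noteq> {}"
      using h[OF A] open_Int_closure_eq_empty[of ?N "ev ` A"] by blast
    then show ?thesis by (force simp: ev_def dist_real_def abs_minus_commute)
  qed
  ultimately have "Abs_cdual h \<in> bidual_closure A" if "A \<in> \<A>" for A
    using that unfolding bidual_closure_iff by simp
  then show ?thesis by (rule that)
qed

text \<open>Otherwise a cluster point \<open>\<phi>\<close> of the offending \<open>b\<close> satisfies \<open>\<phi> \<noteq> x\<close> and \<open>x = \<rho> \<phi> + (1 - \<rho>) \<psi>\<close>, where
  \<open>\<psi> = x - t (\<phi> - x)\<close> with \<open>t = \<rho> / (1 - \<rho>)\<close>. Only \<open>b\<close> needs to range over a bounded set, because the other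
  point is determined by \<open>b\<close> and the combination.\<close>

lemma ext_points_bidual_combination_avoids:
  fixes C :: "'a::locally_convex_space set"
  assumes C: "convex C" and ext: "canonical_embedding x \<in> ext_points (bidual_closure C)"
    and B: "B \<subseteq> C" "tvs_bounded B" and \<rho>: "0 < \<rho>" "\<rho> \<le> 1/2"
    and \<delta>: "\<delta> > 0" "\<And>b. b \<in> B \<Longrightarrow> dual_apply g b \<ge> dual_apply g x + \<delta>"
  shows "\<exists>F e. finite F \<and> e > 0 \<and>
    (\<forall>b\<in>B. \<forall>c\<in>C. \<rho> *\<^sub>R b + (1 - \<rho>) *\<^sub>R c \<notin> weak_ball F e x)"
proof (rule ccontr)
  assume "\<not> ?thesis"
  then have close: "\<exists>b\<in>B. \<exists>c\<in>C. \<rho> *\<^sub>R b + (1 - \<rho>) *\<^sub>R c \<in> weak_ball F e x" if "finite F" "e > 0" for F e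
    using that by blast
  \<comment> \<open>The \<open>b\<close> that occur in a combination weakly close to
    \<open>x\<close>; smaller weak balls give smaller sets, so the family is directed.\<close>
  define A where "A F e = {b\<in>B. \<exists>c\<in>C. \<rho> *\<^sub>R b + (1 - \<rho>) *\<^sub>R c \<in> weak_ball F e x}" for F e
  define \<A> where "\<A> = {A F e | F e. finite F \<and> e > 0}"
  have A_in: "A F e \<in> \<A>" if "finite F" "e > 0" for F e using that by (auto simp: \<A>_def)
  have "\<A> \<noteq> {}" using A_in[of "{}" 1] by auto
  moreover have "D \<noteq> {} \<and> D \<subseteq> B" if "D \<in> \<A>" for D
    using that close by (fastforce simp: \<A>_def A_def)
  moreover have "\<exists>D''\<in>\<A>. D'' \<subseteq> D \<inter> D'" if DD': "D \<in> \<A>" "D' \<in> \<A>" for D D'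
  proof -
    obtain F e F' e' where D: "D = A F e" "finite F" "e > 0" "D' = A F' e'" "finite F'" "e' > 0"
      using DD' by (auto simp: \<A>_def)
    have "weak_ball (F \<union> F') (min e e') x \<subseteq> weak_ball F e x \<inter> weak_ball F' e' x"
      by (auto simp: weak_ball_def)
    then have "A (F \<union> F') (min e e') \<subseteq> D \<inter> D'" by (auto simp: A_def D)
    then show ?thesis using A_in[of "F \<union> F'" "min e e'"] D by auto
  qed
  ultimately obtain \<phi> where \<phi>: "\<And>D. D \<in> \<A> \<Longrightarrow> \<phi> \<in> bidual_closure D"
    using bidual_closure_cluster[OF B(2)] by blast
  then have approx: "\<exists>b\<in>A F e. \<forall>f\<in>F. \<bar>dual_apply f b - dual_apply \<phi> f\<bar> < e" if "finite F" "e > 0" for F e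
    using A_in[OF that] that unfolding bidual_closure_iff by blast
  have "\<phi> \<in> bidual_closure C"
    using \<phi>[OF A_in[of "{}" 1]] bidual_closure_mono[of "A {} 1" C] B(1) by (auto simp: A_def)
  \<comment> \<open>At \<open>g\<close>, \<phi> is within \<delta> of some \<open>b\<close> in
    \<open>B\<close>, where \<open>g\<close> exceeds its value at \<open>x\<close> by at least
    \<delta>.\<close>
  have "dual_apply \<phi> g > dual_apply g x"
    using approx[of "{g}" \<delta>] \<delta> by (force simp: A_def)
  then have neq: "\<phi> \<noteq> canonical_embedding x" by (auto simp: canonical_embedding.rep_eq)
  define t where "t = \<rho> / (1 - \<rho>)"
  have t: "0 < t" "t \<le> 1" using \<rho> by (auto simp: t_def field_simps)
  let ?x = "canonical_embedding x"
  define \<psi> where "\<psi> = ?x - t *\<^sub>R (\<phi> - ?x)"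
  have "\<psi> \<in> bidual_closure C"
    unfolding bidual_closure_iff
  proof (intro allI impI)
    fix F :: "'a cdual set" and e :: real assume F: "finite F" "e > 0"
    \<comment> \<open>Two errors below \<open>e'\<close> add up to less than
      \<open>(1 - \<rho>) * e\<close>, and solving the combination for \<open>c\<close> divides by
      \<open>1 - \<rho>\<close>.\<close>
    define e' where "e' = (1 - \<rho>) * e / 2"
    have "e' > 0" using F \<rho> by (simp add: e'_def)
    then obtain b c where b: "\<And>f. f \<in> F \<Longrightarrow> \<bar>dual_apply f b - dual_apply \<phi> f\<bar> < e'"
      and c: "c \<in> C" "\<rho> *\<^sub>R b + (1 - \<rho>) *\<^sub>R c \<in> weak_ball F e' x"
      using approx[of F e'] F by (auto simp: A_def)
    have "\<bar>dual_apply f c - dual_apply \<psi> f\<bar> < e" if "f \<in> F" for f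
    proof -
      let ?u = "\<rho> * dual_apply f b + (1 - \<rho>) * dual_apply f c - dual_apply f x"
      let ?v = "dual_apply f b - dual_apply \<phi> f"
      have "\<bar>?u\<bar> < e'"
        using c(2) that by (simp add: weak_ball_def dual_apply_add dual_apply_scaleR)
      moreover have "\<bar>\<rho> * ?v\<bar> \<le> \<bar>?v\<bar>"
        using \<rho> by (simp add: abs_mult mult_left_le_one_le)
      ultimately have "\<bar>?u - \<rho> * ?v\<bar> < e' + e'"
        using b[OF that] abs_triangle_ineq4[of ?u "\<rho> * ?v"] by linarith
      moreover have "e' + e' = (1 - \<rho>) * e" by (simp add: e'_def)
      moreover have "(1 - \<rho>) * t = \<rho>" using \<rho> by (simp add: t_def)
      then have "(1 - \<rho>) * dual_apply \<psi> f = (1 - \<rho>) * dual_apply f x - \<rho> * (dual_apply \<phi> f - dual_apply f x)"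
        by (simp add: \<psi>_def minus_cdual.rep_eq scaleR_cdual.rep_eq canonical_embedding.rep_eq
            right_diff_distrib flip: mult.assoc)
      then have "?u - \<rho> * ?v = (1 - \<rho>) * (dual_apply f c - dual_apply \<psi> f)"
        by (simp add: algebra_simps)
      ultimately show ?thesis using \<rho> by (simp add: abs_mult)
    qed
    then show "\<exists>c\<in>C. \<forall>f\<in>F. \<bar>dual_apply f c - dual_apply \<psi> f\<bar> < e" using c(1) by blast
  qed
  \<comment> \<open>\<open>ext_points\<close> speaks of midpoints only, so \<phi> is replaced by the
    reflection of \<psi> at \<open>x\<close>. It lies between \<open>x\<close> and \<phi> because
    \<open>t \<le> 1\<close>.\<close>
  moreover have "(1 - t) *\<^sub>R ?x + t *\<^sub>R \<phi> \<in> bidual_closure C"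
    using convex_bidual_closure[OF C] ext \<open>\<phi> \<in> bidual_closure C\<close> t
    by (intro convexD) (auto simp: ext_points_def)
  moreover have "(1 - t) *\<^sub>R ?x + t *\<^sub>R \<phi> + \<psi> = 2 *\<^sub>R ?x"
    by (simp add: \<psi>_def algebra_simps scaleR_2)
  then have "?x = ((1 - t) *\<^sub>R ?x + t *\<^sub>R \<phi> + \<psi>) /\<^sub>R 2" by simp
  ultimately have "?x = \<psi>" using ext unfolding ext_points_def by blast
  then show False using t neq by (simp add: \<psi>_def)
qed

text \<open>Averaging two such points averages their scales to \<sigma> and weights
  \<open>z\<close>, \<open>z'\<close> by their shares of \<sigma>, which gives a point of
  \<open>K\<close>. Thus an inclusion of \<open>C - U\<close> in this set extends to its
  hull.\<close>

lemma convex_rays_beyond: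
  fixes x :: "'a::real_vector"
  assumes K: "convex K"
  shows "convex {x + s *\<^sub>R (z - x) | s z. s \<ge> 1 \<and> z \<in> K}"
  unfolding convex_alt
proof (intro ballI allI impI)
  fix y y' and u :: real
  assume "y \<in> {x + s *\<^sub>R (z - x) | s z. s \<ge> 1 \<and> z \<in> K}" "y' \<in> {x + s *\<^sub>R (z - x) | s z. s \<ge> 1 \<and> z \<in> K}"
  then obtain s z s' z' where y: "y = x + s *\<^sub>R (z - x)" "s \<ge> 1" "z \<in> K" "y' = x + s' *\<^sub>R (z' - x)" "s' \<ge> 1" "z' \<in> K"
    by auto
  assume u: "0 \<le> u \<and> u \<le> 1"
  define \<sigma> where "\<sigma> = (1 - u) * s + u * s'"
  have "(1 - u) * 1 + u * 1 \<le> \<sigma>"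
    unfolding \<sigma>_def using y u by (intro add_mono mult_left_mono) auto
  then have \<sigma>: "\<sigma> \<ge> 1" by simp
  define w where "w = ((1 - u) * s / \<sigma>) *\<^sub>R z + (u * s' / \<sigma>) *\<^sub>R z'"
  have "w \<in> K"
    unfolding w_def using y u \<sigma>
    by (intro convexD[OF K]) (auto simp: \<sigma>_def simp flip: add_divide_distrib)
  have "\<sigma> *\<^sub>R w = ((1 - u) * s) *\<^sub>R z + (u * s') *\<^sub>R z'"
    using \<sigma> by (simp add: w_def scaleR_right_distrib)
  then have "(1 - u) *\<^sub>R y + u *\<^sub>R y' = x + \<sigma> *\<^sub>R (w - x)"
    by (simp add: y \<sigma>_def algebra_simps)
  then show "(1 - u) *\<^sub>R y + u *\<^sub>R y' \<in> {x + s *\<^sub>R (z - x) | s z. s \<ge> 1 \<and> z \<in> K}"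
    using \<sigma> \<open>w \<in> K\<close> by blast
qed

text \<open>Some weight is at least \<rho>, since otherwise the sum would be below 1. Splitting
  \<rho> off that weight and dividing the rest by \<open>1 - \<rho>\<close> leaves a convex
  combination in \<open>C\<close>.\<close>

lemma convex_combination_pigeonhole:
  fixes C :: "'a::real_vector set" and \<mu> :: "'i \<Rightarrow> real" and \<rho> :: real
  assumes C: "convex C" and J: "finite J" "sum \<mu> J = 1" "\<And>j. j \<in> J \<Longrightarrow> \<mu> j \<ge> 0"
    and d: "\<And>j. j \<in> J \<Longrightarrow> d j \<in> C" and \<rho>: "0 \<le> \<rho>" "\<rho> < 1" "card J * \<rho> < 1"
  obtains j c where "j \<in> J" "c \<in> C" "(\<Sum>j\<in>J. \<mu> j *\<^sub>R d j) = \<rho> *\<^sub>R d j + (1 - \<rho>) *\<^sub>R c"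
proof -
  have "\<exists>j\<in>J. \<rho> \<le> \<mu> j"
  proof (rule ccontr)
    assume "\<not> ?thesis"
    then have "sum \<mu> J \<le> card J * \<rho>" by (intro sum_bounded_above) auto
    then show False using J \<rho> by simp
  qed
  then obtain j where j: "j \<in> J" "\<rho> \<le> \<mu> j" by blast
  define \<nu> where "\<nu> k = (\<mu> k - (if k = j then \<rho> else 0)) / (1 - \<rho>)" for k
  have "sum \<nu> J = 1"
    using J(1,2) j(1) \<rho> by (simp add: \<nu>_def sum_subtractf flip: sum_divide_distrib)
  then have "(\<Sum>k\<in>J. \<nu> k *\<^sub>R d k) \<in> C"
    using J j \<rho> d by (intro convex_sum[OF J(1) C]) (auto simp: \<nu>_def)
  moreover have "(1 - \<rho>) *\<^sub>R (\<Sum>k\<in>J. \<nu> k *\<^sub>R d k) = (\<Sum>k\<in>J. \<mu> k *\<^sub>R d k - (if k = j then \<rho> *\<^sub>R d j else 0))"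
    unfolding scaleR_sum_right using \<rho> by (intro sum.cong) (auto simp: \<nu>_def scaleR_left_diff_distrib)
  then have "(\<Sum>k\<in>J. \<mu> k *\<^sub>R d k) = \<rho> *\<^sub>R d j + (1 - \<rho>) *\<^sub>R (\<Sum>k\<in>J. \<nu> k *\<^sub>R d k)"
    using J(1) j(1) by (simp add: sum_subtractf)
  ultimately show ?thesis using j(1) that by blast
qed

section \<open>Denting points\<close>

text \<open>Separates \<open>x\<close> from the hull of \<open>C - U\<close>; Hahn--Banach enters
  the proof only through this slice.\<close>

lemma DP_slice:
  assumes "x \<in> DP C" "U \<in> nbhds_of euclidean x"
  obtains g \<alpha> where "\<alpha> < dual_apply g x" "\<And>c. c \<in> C \<Longrightarrow> \<alpha> < dual_apply g c \<Longrightarrow> c \<in> U"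
proof -
  have "x \<notin> closure (convex hull (C - U))" using assms by (auto simp: DP_def)
  then obtain g \<alpha> where g: "\<alpha> < dual_apply g x"
    "\<And>a. a \<in> convex hull (C - U) \<Longrightarrow> dual_apply g a \<le> \<alpha>"
    using separate_point_convex[OF convex_convex_hull] by blast
  have "c \<in> U" if "c \<in> C" "\<alpha> < dual_apply g c" for c
  proof (rule ccontr)
    assume "c \<notin> U"
    then have "c \<in> convex hull (C - U)"
      using that(1) by (intro hull_inc) simp
    then show False using g(2) that(2) by fastforce
  qed
  then show ?thesis using g(1) that by blast
qed

lemma slice_nbhd: "\<alpha> < dual_apply g x \<Longrightarrow> {y. \<alpha> < dual_apply g y} \<in> nbhds_of euclidean x"
  unfolding nbhds_of_euclidean
  by (intro exI[of _ "{y. \<alpha> < dual_apply g y}"] conjI open_Collect_less continuous_on_dual_apply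
      continuous_on_const) auto

text \<open>A slice around \<open>x\<close> contains the part in \<open>C\<close> of a weak ball of
  its single functional, with radius the height of \<open>x\<close> above the level.\<close>

lemma DP_subset_PC: "DP C \<subseteq> PC C"
proof
  fix x assume x: "x \<in> DP C"
  have "\<exists>W\<in>nbhds_of weak_topology x. W \<inter> C \<subseteq> U" if "U \<in> nbhds_of euclidean x" for U
  proof -
    obtain g \<alpha> where g: "\<alpha> < dual_apply g x" "\<And>c. c \<in> C \<Longrightarrow> \<alpha> < dual_apply g c \<Longrightarrow> c \<in> U"
      using DP_slice[OF x \<open>U \<in> nbhds_of euclidean x\<close>] by blast
    let ?W = "weak_ball {g} (dual_apply g x - \<alpha>) x"
    have "?W \<in> nbhds_of weak_topology x"
      unfolding nbhds_of_weak using g(1) by (intro exI[of _ "{g}"] exI[of _ "dual_apply g x - \<alpha>"]) simp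
    moreover have "?W \<inter> C \<subseteq> U" using g(2) by (auto simp: weak_ball_def abs_less_iff)
    ultimately show ?thesis by blast
  qed
  then show "x \<in> PC C" using x by (auto simp: PC_def DP_def)
qed

text \<open>If the midpoint of \<open>c\<close> and \<open>c'\<close> is near \<open>x\<close>, one of the two lies in a small slice around \<open>x\<close>,
  and then so does, up to a factor 3, its reflection through the midpoint.\<close>

lemma DP_subset_weak_s_ext: "DP C \<subseteq> weak_s_ext C"
proof
  fix x assume x: "x \<in> DP C"
  have "\<exists>U\<in>nbhds_of euclidean x. \<forall>c\<in>C. \<forall>c'\<in>C. (c + c') /\<^sub>R 2 \<in> U \<longrightarrow> c \<in> W"
    if W: "W \<in> nbhds_of weak_topology x" for W
  proof -
    obtain F e where F: "finite F" "e > 0" "weak_ball F e x \<subseteq> W"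
      using W unfolding nbhds_of_weak by blast
    have small: "weak_ball F (e/3) x \<in> nbhds_of euclidean x"
      using F by (intro weak_ball_nbhd) auto
    obtain g \<alpha> where g: "\<alpha> < dual_apply g x"
      "\<And>c. c \<in> C \<Longrightarrow> \<alpha> < dual_apply g c \<Longrightarrow> c \<in> weak_ball F (e/3) x"
      using DP_slice[OF x small] by blast
    let ?U = "weak_ball F (e/3) x \<inter> {y. \<alpha> < dual_apply g y}"
    have "c \<in> weak_ball F e x" if c: "c \<in> C" "c' \<in> C" "(c + c') /\<^sub>R 2 \<in> ?U" for c c'
    proof (cases "\<alpha> < dual_apply g c")
      case True
      then have "c \<in> weak_ball F (e/3) x" using g(2) c(1) by blast
      then show ?thesis using F(2) by (force simp: weak_ball_def)
    next
      case False
      have mid: "2 * dual_apply f ((c + c') /\<^sub>R 2) = dual_apply f c + dual_apply f c'" for f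
        by (simp add: dual_apply_scaleR dual_apply_add)
      \<comment> \<open>As \<open>g\<close> exceeds \<alpha> at the midpoint but not at
        \<open>c\<close>, it does so at \<open>c'\<close>.\<close>
      have "\<alpha> < dual_apply g ((c + c') /\<^sub>R 2)" using c(3) by simp
      then have "c' \<in> weak_ball F (e/3) x"
        using g(2)[OF c(2)] False mid[of g] by linarith
      then have near: "c' \<in> weak_ball F (e/3) x" "(c + c') /\<^sub>R 2 \<in> weak_ball F (e/3) x"
        using c(3) by auto
      have "\<bar>dual_apply f c - dual_apply f x\<bar> < e" if "f \<in> F" for f
      proof -
        have "\<bar>dual_apply f c' - dual_apply f x\<bar> < e/3"
          "\<bar>dual_apply f ((c + c') /\<^sub>R 2) - dual_apply f x\<bar> < e/3"
          using near \<open>f \<in> F\<close> unfolding weak_ball_def by blast+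
        then show ?thesis using mid[of f] unfolding abs_less_iff by linarith
      qed
      then show ?thesis by (simp add: weak_ball_def)
    qed
    moreover have "?U \<in> nbhds_of euclidean x"
      using small slice_nbhd[OF g(1)] by (rule nbhds_of_Int)
    ultimately show ?thesis using F(3) by blast
  qed
  then show "x \<in> weak_s_ext C"
    using x unfolding weak_s_ext_iff by (auto simp: DP_def)
qed

text \<open>Approximants \<open>c\<close> of \<open>d1\<close> and \<open>c'\<close> of
  \<open>d2\<close> have their midpoint in \<open>U\<close>, so strong extremality keeps
  \<open>c\<close> near \<open>x\<close> at \<open>g\<close>, where it is near \<open>d1\<close> as
  well. Exchanging \<open>d1\<close> and \<open>d2\<close> gives the other half of
  extremality.\<close>

lemma PC_weak_s_ext_bidual_midpoint:
  assumes C: "convex C" and x: "x \<in> PC C" "x \<in> weak_s_ext C"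
    and d: "d1 \<in> bidual_closure C" "d2 \<in> bidual_closure C"
    and mid: "canonical_embedding x = (d1 + d2) /\<^sub>R 2"
  shows "canonical_embedding x = d1"
proof (rule ccontr)
  assume "canonical_embedding x \<noteq> d1"
  then obtain g where "dual_apply (canonical_embedding x) g \<noteq> dual_apply d1 g"
    by (metis dual_apply_inject ext)
  then have g: "dual_apply g x \<noteq> dual_apply d1 g" by (simp add: canonical_embedding.rep_eq)
  define \<eta> where "\<eta> = \<bar>dual_apply g x - dual_apply d1 g\<bar> / 2"
  have \<eta>: "\<eta> > 0" using g by (simp add: \<eta>_def)
  then have "weak_ball {g} \<eta> x \<in> nbhds_of weak_topology x"
    unfolding nbhds_of_weak by (intro exI[of _ "{g}"] exI[of _ \<eta>]) simp
  then obtain U where U: "U \<in> nbhds_of euclidean x"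
    "\<And>c c'. c \<in> C \<Longrightarrow> c' \<in> C \<Longrightarrow> (c + c') /\<^sub>R 2 \<in> U \<Longrightarrow> c \<in> weak_ball {g} \<eta> x"
    using x(2) unfolding weak_s_ext_iff by blast
  obtain W where W: "W \<in> nbhds_of weak_topology x" "W \<inter> C \<subseteq> U"
    using x(1) U(1) by (auto simp: PC_def)
  obtain F e where F: "finite F" "e > 0" "weak_ball F e x \<subseteq> W"
    using W(1) unfolding nbhds_of_weak by blast
  obtain c where c: "c \<in> C" "\<And>f. f \<in> insert g F \<Longrightarrow> \<bar>dual_apply f c - dual_apply d1 f\<bar> < min e \<eta>"
    using d(1)[unfolded bidual_closure_iff, rule_format, of "insert g F" "min e \<eta>"] F \<eta> by auto
  obtain c' where c': "c' \<in> C" "\<And>f. f \<in> F \<Longrightarrow> \<bar>dual_apply f c' - dual_apply d2 f\<bar> < e"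
    using d(2)[unfolded bidual_closure_iff, rule_format, of F e] F by auto
  have "(c + c') /\<^sub>R 2 \<in> weak_ball F e x"
    unfolding weak_ball_def
  proof (intro CollectI ballI)
    fix f assume f: "f \<in> F"
    have "dual_apply f x = dual_apply ((d1 + d2) /\<^sub>R 2) f"
      unfolding mid[symmetric] by (simp add: canonical_embedding.rep_eq)
    then have "2 * dual_apply f x = dual_apply d1 f + dual_apply d2 f"
      by (simp add: scaleR_cdual.rep_eq plus_cdual.rep_eq)
    moreover have "2 * dual_apply f ((c + c') /\<^sub>R 2) = dual_apply f c + dual_apply f c'"
      by (simp add: dual_apply_scaleR dual_apply_add)
    ultimately show "\<bar>dual_apply f ((c + c') /\<^sub>R 2) - dual_apply f x\<bar> < e"
      using c(2)[of f] c'(2)[of f] f by (simp add: abs_less_iff)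
  qed
  moreover have "(c + c') /\<^sub>R 2 \<in> C"
    using convexD[OF C c(1) c'(1), of "1/2" "1/2"] by (simp add: scaleR_right_distrib)
  ultimately have "c \<in> weak_ball {g} \<eta> x"
    using U(2)[OF c(1) c'(1)] F(3) W(2) by blast
  then have "\<bar>dual_apply g c - dual_apply g x\<bar> < \<eta>" by (simp add: weak_ball_def)
  moreover have "\<bar>dual_apply g c - dual_apply d1 g\<bar> < \<eta>" using c(2)[of g] by simp
  moreover have "\<bar>dual_apply g x - dual_apply d1 g\<bar> = 2 * \<eta>" by (simp add: \<eta>_def)
  ultimately show False by linarith
qed

text \<open>Each piece \<open>D g\<close> is bounded and at height at least \<delta> above
  \<open>x\<close> along \<open>g\<close>, as \<open>ext_points_bidual_combination_avoids\<close>
  requires.\<close>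

lemma bPC_ext_bidual_subset_DP:
  fixes C :: "'a::locally_convex_space set"
  assumes C: "convex C" and x: "x \<in> bPC C" and ext: "canonical_embedding x \<in> ext_points (bidual_closure C)"
  shows "x \<in> DP C"
proof -
  have xC: "x \<in> C" using x by (simp add: bPC_def PC_def)
  have "x \<notin> closure (convex hull (C - U))" if U: "U \<in> nbhds_of euclidean x" for U
  proof
    assume in_closure: "x \<in> closure (convex hull (C - U))"
    obtain W0 where W0: "W0 \<in> nbhds_of weak_topology x" "tvs_bounded (W0 \<inter> C)"
      using x by (auto simp: bPC_def)
    obtain W1 where W1: "W1 \<in> nbhds_of weak_topology x" "W1 \<inter> C \<subseteq> U"
      using x U by (auto simp: bPC_def PC_def)
    obtain F e where F: "finite F" "e > 0" "weak_ball F e x \<subseteq> W0 \<inter> W1"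
      using nbhds_of_Int[OF W0(1) W1(1)] unfolding nbhds_of_weak by blast
    \<comment> \<open>With half of \<open>e\<close> the closed slab \<open>B\<close> fits into the
      weak ball, while every point of \<open>C - U\<close> lies strictly outside the slab.\<close>
    define \<delta> where "\<delta> = e / 2"
    have \<delta>: "\<delta> > 0" "\<delta> < e" using F(2) by (auto simp: \<delta>_def)
    define B where "B = C \<inter> (\<Inter>f\<in>F. dual_apply f -` cball (dual_apply f x) \<delta>)"
    have "B \<subseteq> weak_ball F e x"
      using \<delta> by (force simp: B_def weak_ball_def dist_real_def)
    then have "tvs_bounded B"
      using F(3) by (intro tvs_bounded_subset[OF W0(2)]) (auto simp: B_def)
    have "convex B"
      unfolding B_def by (intro convex_Int C convex_INT convex_dual_apply_vimage convex_cball)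
    define D where "D g = B \<inter> dual_apply g -` {dual_apply g x + \<delta>..}" for g
    have convD: "convex (D g)" for g
      unfolding D_def by (intro convex_Int \<open>convex B\<close> convex_dual_apply_vimage convex_real_interval)
    \<comment> \<open>Empty pieces are dropped because a point of the hull is later written with one
      point from each piece.\<close>
    define J where "J = {g \<in> F \<union> uminus ` F. D g \<noteq> {}}"
    have "finite J" using F(1) by (simp add: J_def)
    \<comment> \<open>The summand 2 keeps \<rho> at most 1/2 even for empty \<open>J\<close>, and
      \<open>card J * \<rho>\<close> below 1.\<close>
    define \<rho> :: real where "\<rho> = 1 / (card J + 2)"
    have \<rho>: "0 < \<rho>" "\<rho> \<le> 1/2" "card J * \<rho> < 1" by (auto simp: \<rho>_def field_simps)
    have "\<exists>G d. finite G \<and> d > 0 \<and> (\<forall>b\<in>D g. \<forall>c\<in>C. \<rho> *\<^sub>R b + (1 - \<rho>) *\<^sub>R c \<notin> weak_ball G d x)" for g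
    proof (rule ext_points_bidual_combination_avoids[OF C ext _ _ \<rho>(1,2) \<delta>(1)])
      show "D g \<subseteq> C" by (auto simp: D_def B_def)
      show "tvs_bounded (D g)" by (rule tvs_bounded_subset[OF \<open>tvs_bounded B\<close>]) (auto simp: D_def)
    qed (auto simp: D_def)
    then obtain G d where G: "\<And>g. finite (G g)" "\<And>g. d g > 0"
      "\<And>g b c. b \<in> D g \<Longrightarrow> c \<in> C \<Longrightarrow> \<rho> *\<^sub>R b + (1 - \<rho>) *\<^sub>R c \<notin> weak_ball (G g) (d g) x"
      by metis
    define V where "V = (\<Inter>g\<in>J. weak_ball (G g) (d g) x)"
    have "open V" unfolding V_def using \<open>finite J\<close> G(1) by (intro open_INT ballI open_weak_ball)
    moreover have "x \<in> V" using G(2) by (auto simp: V_def weak_ball_def)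
    ultimately have "V \<inter> convex hull (C - U) \<noteq> {}"
      using in_closure open_Int_closure_eq_empty by blast
    then obtain y where y: "y \<in> V" "y \<in> convex hull (C - U)" by blast
    let ?K = "convex hull (\<Union>(D ` J))"
    let ?H = "{x + s *\<^sub>R (z - x) | s z. s \<ge> 1 \<and> z \<in> ?K}"
    have "C - U \<subseteq> ?H"
    proof
      fix c assume c: "c \<in> C - U"
      then have "c \<notin> weak_ball F e x" using W1(2) F(3) by blast
      then obtain f0 where f0: "f0 \<in> F" "e \<le> \<bar>dual_apply f0 c - dual_apply f0 x\<bar>"
        by (auto simp: weak_ball_def not_less)
      \<comment> \<open>Pulling \<open>c\<close> towards \<open>x\<close> by the factor
        \<open>s = M / \<delta>\<close> makes the largest deviation over \<open>F\<close> exactly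
        \<delta>; the functional attaining it, or its negative, names the piece that contains
        \<open>z\<close>.\<close>
      define m where "m = (\<lambda>f. \<bar>dual_apply f c - dual_apply f x\<bar>)"
      define M where "M = Max (m ` F)"
      have m_le: "m f \<le> M" if "f \<in> F" for f using that F(1) by (simp add: M_def)
      have "M \<in> m ` F" unfolding M_def using F(1) f0(1) by (intro Max_in) auto
      then obtain f1 where f1: "f1 \<in> F" "m f1 = M" by auto
      have "\<delta> < M" using m_le[OF f0(1)] f0(2) \<delta> by (simp add: m_def)
      define s where "s = M / \<delta>"
      have s: "s \<ge> 1" "M / s = \<delta>" using \<open>\<delta> < M\<close> \<delta> by (auto simp: s_def)
      define z where "z = (1 - 1/s) *\<^sub>R x + (1/s) *\<^sub>R c"
      have z: "dual_apply f z - dual_apply f x = (dual_apply f c - dual_apply f x) / s" for f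
      proof -
        have "z = x + (1/s) *\<^sub>R (c - x)" by (simp add: z_def algebra_simps)
        then show ?thesis by (simp add: dual_apply_add dual_apply_scaleR dual_apply_diff)
      qed
      have abs_z: "\<bar>dual_apply f z - dual_apply f x\<bar> = m f / s" for f
        unfolding z using s by (simp add: m_def)
      have "z \<in> C" unfolding z_def using c xC s by (intro convexD[OF C]) auto
      moreover have "\<bar>dual_apply f z - dual_apply f x\<bar> \<le> \<delta>" if "f \<in> F" for f
        unfolding abs_z s(2)[symmetric] using m_le[OF that] s(1) by (intro divide_right_mono) auto
      ultimately have "z \<in> B" by (auto simp: B_def dist_real_def abs_minus_commute)
      have "\<bar>dual_apply f1 z - dual_apply f1 x\<bar> = \<delta>" using f1(2) s(2) abs_z by simp
      then have "z \<in> D f1 \<or> z \<in> D (- f1)"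
        using \<open>z \<in> B\<close> by (auto simp: D_def uminus_cdual.rep_eq abs_if split: if_splits)
      then have "z \<in> \<Union>(D ` J)" using f1(1) by (auto simp: J_def)
      then have "z \<in> ?K" by (rule hull_inc)
      moreover have "c = x + s *\<^sub>R (z - x)"
        using s(1) by (simp add: z_def algebra_simps)
      ultimately show "c \<in> ?H" using s(1) by blast
    qed
    then have "convex hull (C - U) \<subseteq> ?H"
      by (intro hull_minimal convex_rays_beyond convex_convex_hull)
    then obtain s z where s: "y = x + s *\<^sub>R (z - x)" "s \<ge> 1" "z \<in> ?K" using y(2) by blast
    \<comment> \<open>Each deviation of \<open>z\<close> from \<open>x\<close> is that of
      \<open>y\<close> divided by \<open>s \<ge> 1\<close>.\<close>
    have "z \<in> V"
      unfolding V_def weak_ball_def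
    proof (intro INT_I CollectI ballI)
      fix g f assume gf: "g \<in> J" "f \<in> G g"
      have "dual_apply f y - dual_apply f x = s * (dual_apply f z - dual_apply f x)"
        by (simp add: s(1) dual_apply_add dual_apply_scaleR dual_apply_diff)
      then have "\<bar>dual_apply f y - dual_apply f x\<bar> = s * \<bar>dual_apply f z - dual_apply f x\<bar>"
        using s(2) by (simp add: abs_mult)
      moreover have "\<bar>dual_apply f z - dual_apply f x\<bar> \<le> s * \<bar>dual_apply f z - dual_apply f x\<bar>"
        using s(2) by (simp add: mult_le_cancel_right1)
      moreover have "\<bar>dual_apply f y - dual_apply f x\<bar> < d g"
        using y(1) gf by (auto simp: V_def weak_ball_def)
      ultimately show "\<bar>dual_apply f z - dual_apply f x\<bar> < d g" by simp
    qed
    have "\<forall>g\<in>J. convex (D g) \<and> D g \<noteq> {}" using convD by (simp add: J_def)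
    then obtain \<mu> p where \<mu>: "z = (\<Sum>g\<in>J. \<mu> g *\<^sub>R p g)" "\<forall>g\<in>J. \<mu> g \<ge> 0" "sum \<mu> J = 1" "\<forall>g\<in>J. p g \<in> D g"
      using s(3) convex_hull_finite_union[OF \<open>finite J\<close>, of D] by auto
    have "p g \<in> C" if "g \<in> J" for g using \<mu>(4) that by (auto simp: D_def B_def)
    \<comment> \<open>Splitting off weight \<rho> at one piece gives a combination excluded by the
      choice of \<open>G\<close> and \<open>d\<close>.\<close>
    then obtain j c where j: "j \<in> J" "c \<in> C" "z = \<rho> *\<^sub>R p j + (1 - \<rho>) *\<^sub>R c"
      using convex_combination_pigeonhole[OF C \<open>finite J\<close> \<mu>(3), of p \<rho>] \<mu>(1,2) \<rho> by auto
    then have "z \<notin> weak_ball (G j) (d j) x" using G(3) \<mu>(4) by blast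
    then show False using \<open>z \<in> V\<close> j(1) by (auto simp: V_def)
  qed
  then show ?thesis using xC by (simp add: DP_def)
qed

theorem theorem2p12:
  fixes C :: "'a::locally_convex_space set"
  assumes "convex C"
  shows "bDP C = bPC C \<inter> weak_s_ext C \<and>
         bPC C \<inter> weak_s_ext C = bPC C \<inter> canonical_embedding -` ext_points (bidual_closure C)"
proof -
  \<comment> \<open>The three sets are joined by a cycle of inclusions; the boundedness clause is
    common to \<open>bDP\<close> and \<open>bPC\<close>.\<close>
  have "bDP C \<subseteq> bPC C \<inter> weak_s_ext C"
    using DP_subset_PC DP_subset_weak_s_ext by (auto simp: bDP_def bPC_def)
  moreover have "canonical_embedding x \<in> ext_points (bidual_closure C)"
    if "x \<in> bPC C" "x \<in> weak_s_ext C" for x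
  proof -
    have x: "x \<in> C" "x \<in> PC C" using that(1) by (auto simp: bPC_def PC_def)
    have "canonical_embedding x \<in> bidual_closure C"
      using x(1) by (auto simp: bidual_closure_iff canonical_embedding.rep_eq intro!: bexI[of _ x])
    then show ?thesis
      using PC_weak_s_ext_bidual_midpoint[OF assms x(2) that(2)] unfolding ext_points_def
      by (smt (verit, best) add.commute mem_Collect_eq)
  qed
  moreover have "bPC C \<inter> canonical_embedding -` ext_points (bidual_closure C) \<subseteq> bDP C"
    using bPC_ext_bidual_subset_DP[OF assms] by (auto simp: bDP_def bPC_def)
  ultimately show ?thesis by blast
qed

end
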